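(* Fix $p\ge2$ and consider the $p$-spin Curie–Weiss model, i.e. the $p$-tensor Ising model with $J_{i_1\dots i_p}=N^{1-p}$ for all $1\le i_1,\dots,i_p\le N$. Let $g(t)=\beta t^p-I(t)$ on $[-1,1]$. Then for every $\beta>\beta^*_{\mathrm{CW}}(p)$, $g$ has a unique positive global maximizer $m_*=m_*(\beta,p)$ and, as $N\to\infty$, $\sqrt N(\hat\beta_N(\bm X)-\beta)\to N\big(0,-\frac{g''(m_* )}{p^2m_*^{2p-2}}\big)$ in distribution, where $\bm X\sim\mathbb P_\beta$.
   Context: With $J_{i_1\dots i_p}=N^{1-p}$, the model is $\mathbb P_\beta(\bm X)\propto e^{\beta H_N(\bm X)}$ on $\{-1,1\}^N$ with $H_N(\bm X)=\sum_{i_1,\dots,i_p}J_{i_1\dots i_p}X_{i_1}\cdots X_{i_p}=N\bar X_N^p$, $\bar X_N=N^{-1}\sum_iX_i$. With $m_i(\bm X)=\sum_{i_2,\dots,i_p}J_{ii_2\dots i_p}X_{i_2}\cdots X_{i_p}$, the MPL estimate is $\hat\beta_N(\bm X)=\inf\{b\ge0:H_N(\bm X)=\sum_im_i(\bm X)\tanh(pb\,m_i(\bm X))\}$ (inf of empty set $=+\infty$). $I(t)=\frac12[(1+t)\log(1+t)+(1-t)\log(1-t)]$ and $\beta^*_{\mathrm{CW}}(p)=\sup\{\beta\ge0:\sup_{t\in[0,1]}(\beta t^p-I(t))=0\}$. *)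

theory Defs
  imports "HOL-Probability.Probability"
begin

definition cw_configs :: "nat \<Rightarrow> (nat \<Rightarrow> real) set" where
  "cw_configs N = PiE {0..<N} (\<lambda>_. {-1, 1})"

definition cw_J :: "nat \<Rightarrow> nat \<Rightarrow> real" where
  "cw_J p N = 1 / real N ^ (p - 1)"

definition cw_H :: "nat \<Rightarrow> nat \<Rightarrow> (nat \<Rightarrow> real) \<Rightarrow> real" where
  "cw_H p N X = (\<Sum>ix\<in>PiE {0..<p} (\<lambda>_. {0..<N}). cw_J p N * (\<Prod>k<p. X (ix k)))"

text \<open>m_i(X) = sum over (i_2,...,i_p) in [N]^(p-1) of J_{i i_2 ... i_p} X_{i_2} ... X_{i_p};
  the tuple (i_2..i_p) is a function {1..<p} -> {0..<N}.\<close>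
definition cw_m :: "nat \<Rightarrow> nat \<Rightarrow> (nat \<Rightarrow> real) \<Rightarrow> nat \<Rightarrow> real" where
  "cw_m p N X i = (\<Sum>ix\<in>PiE {1..<p} (\<lambda>_. {0..<N}). cw_J p N * (\<Prod>k\<in>{1..<p}. X (ix k)))"

text \<open>Maximum pseudo-likelihood estimate, valued in the extended reals
  (Inf of the empty set is +infinity).\<close>
definition mpl_est :: "nat \<Rightarrow> nat \<Rightarrow> (nat \<Rightarrow> real) \<Rightarrow> ereal" where
  "mpl_est p N X = Inf (ereal ` {b::real. b \<ge> 0 \<and>
      cw_H p N X = (\<Sum>i<N. cw_m p N X i * tanh (real p * b * cw_m p N X i))})"

definition cw_prob :: "nat \<Rightarrow> nat \<Rightarrow> real \<Rightarrow> ((nat \<Rightarrow> real) set) \<Rightarrow> real" where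
  "cw_prob p N \<beta> A =
     (\<Sum>X\<in>cw_configs N \<inter> A. exp (\<beta> * cw_H p N X)) / (\<Sum>X\<in>cw_configs N. exp (\<beta> * cw_H p N X))"

definition xlogx :: "real \<Rightarrow> real" where
  "xlogx x = (if x = 0 then 0 else x * ln x)"

definition cw_I :: "real \<Rightarrow> real" where
  "cw_I t = (xlogx (1 + t) + xlogx (1 - t)) / 2"

definition cw_g :: "real \<Rightarrow> nat \<Rightarrow> real \<Rightarrow> real" where
  "cw_g \<beta> p t = \<beta> * t ^ p - cw_I t"

definition cw_beta_star :: "nat \<Rightarrow> real" where
  "cw_beta_star p = Sup {\<beta>::real. \<beta> \<ge> 0 \<and> (SUP t\<in>{0..1}. \<beta> * t ^ p - cw_I t) = 0}"

definition normal_cdf :: "real \<Rightarrow> real \<Rightarrow> real" where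
  "normal_cdf v x = measure (density lborel (normal_density 0 (sqrt v))) {..x}"

end

theory Submission
  imports Defs "HOL-Real_Asymp.Real_Asymp"
begin

text \<open>Since \<open>m_i(X)\<close> is the \<open>(p - 1)\<close>-st power of the magnetization for every \<open>i\<close>, the estimator is the
  function \<open>t \<mapsto> artanh t / (p t^(p-1))\<close> of a positive magnetization \<open>t\<close>, and \<open>g'(m) = 0\<close> says that
  this function equals \<open>\<beta>\<close> at \<open>m\<close>; its slope there is \<open>- g''(m) / (p m^(p-1))\<close>. By Stirling's formula the
  magnetization has weights proportional to \<open>exp (N (g t - g m))\<close> up to a polynomial factor. As \<open>m\<close> is a
  nondegenerate maximizer, the weights on positive \<open>t\<close>, viewed as a step function of
  \<open>u = sqrt N (t - m)\<close>, converge pointwise to a Gaussian of variance \<open>- 1 / g''(m)\<close> and are dominated by a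
  fixed Gaussian. Negative \<open>t\<close> are exponentially negligible for odd \<open>p\<close> and a mirror image for even \<open>p\<close>.\<close>

subsection \<open>The rate function and its maximizer\<close>

text \<open>The function \<open>g\<close> is not concave on (0,1), so maximality alone would leave
  room for several maximizers, or for one with vanishing second derivative, where fluctuations are
  not of order 1 / sqrt N. What excludes both is the strict inequality g(m) > 0 = g(0) above the
  threshold: it forces \<open>g''\<close> to be positive and later negative to the left of
  \<open>m\<close>, and a sign pattern of this kind cannot turn again, so \<open>g''\<close> is
  negative on all of [m, 1). No normalizing constant is ever evaluated. The numerator of the
  probability and the partition function are limits of the same kind with the same constant, so the
  Stirling constant, the Gaussian normalization and the factor 2 for even \<open>p\<close> all
  cancel. The delicate point of the domination is t near 1: few minus spins remain there, the
  polynomial factor loses its order 1 / sqrt N, and part of the exponential decay has to pay for it.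
  The variance in the theorem is the squared slope times - 1 / g''(m).\<close>

lemma cw_I_minus [simp]: "cw_I (- t) = cw_I t"
  by (simp add: cw_I_def add.commute)

lemma cw_I_0 [simp]: "cw_I 0 = 0"
  by (simp add: cw_I_def xlogx_def)

lemma continuous_on_xlogx: "continuous_on {0..} xlogx"
proof -
  have "(xlogx \<longlongrightarrow> xlogx x) (at x within {0..})" if "x \<ge> 0" for x
  proof (cases "x = 0")
    case True
    have "((\<lambda>x::real. x * ln x) \<longlongrightarrow> 0) (at_right 0)"
      by real_asymp
    moreover have "eventually (\<lambda>x. x * ln x = xlogx x) (at_right 0)"
      by (auto simp: eventually_at_filter xlogx_def)
    ultimately have "(xlogx \<longlongrightarrow> 0) (at_right 0)"
      by (rule Lim_transform_eventually)
    then show ?thesis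
      using True by (simp add: at_within_Ici_at_right xlogx_def)
  next
    case False
    with that have "((\<lambda>x. x * ln x) \<longlongrightarrow> x * ln x) (at x)"
      by (intro tendsto_intros) auto
    moreover have "eventually (\<lambda>x. x * ln x = xlogx x) (at x)"
      using False that
      by (auto simp: xlogx_def intro!: eventually_mono[OF eventually_at_in_open'[of "{0<..}" x]])
    ultimately have "(xlogx \<longlongrightarrow> x * ln x) (at x)"
      by (rule Lim_transform_eventually)
    then show ?thesis
      using False by (auto simp: xlogx_def intro: tendsto_within_subset)
  qed
  then show ?thesis
    by (auto simp: continuous_on_def)
qed

lemma continuous_on_cw_g: "continuous_on {-1..1} (cw_g \<beta> p)"
  unfolding cw_g_def [abs_def] cw_I_def [abs_def]
  by (intro continuous_intros continuous_on_compose2[OF continuous_on_xlogx]) auto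

lemma cw_g_has_real_derivative:
  assumes "\<bar>t\<bar> < 1"
  shows "(cw_g \<beta> p has_real_derivative real p * \<beta> * t ^ (p - 1) - artanh t) (at t)"
proof -
  have *: "((\<lambda>t. \<beta> * t ^ p - ((1 + t) * ln (1 + t) + (1 - t) * ln (1 - t)) / 2)
      has_real_derivative real p * \<beta> * t ^ (p - 1) - artanh t) (at t)"
  proof -
    have "((\<lambda>t. (1 + t) * ln (1 + t)) has_real_derivative ln (1 + t) + 1) (at t)"
         "((\<lambda>t. (1 - t) * ln (1 - t)) has_real_derivative - ln (1 - t) - 1) (at t)"
      using assms by (auto intro!: derivative_eq_intros)
    then have "((\<lambda>t. \<beta> * t ^ p - ((1 + t) * ln (1 + t) + (1 - t) * ln (1 - t)) / 2)
      has_real_derivative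
        \<beta> * (real p * t ^ (p - 1)) - ((ln (1 + t) + 1) + (- ln (1 - t) - 1)) / 2) (at t)"
      by (intro DERIV_diff DERIV_cdivide DERIV_add DERIV_cmult) (auto intro!: derivative_eq_intros)
    moreover have "((ln (1 + t) + 1) + (- ln (1 - t) - 1)) / 2 = artanh t"
      using assms unfolding artanh_def by (subst ln_div) auto
    ultimately show ?thesis
      by (simp only: mult_ac)
  qed
  show ?thesis
  proof (rule has_field_derivative_transform_within_open[OF *])
    show "\<beta> * s ^ p - ((1 + s) * ln (1 + s) + (1 - s) * ln (1 - s)) / 2 = cw_g \<beta> p s"
      if "s \<in> {-1<..<1}" for s
      using that by (simp add: cw_g_def cw_I_def xlogx_def)
  qed (use assms in auto)
qed

lemma cw_g_has_second_derivative:
  assumes "\<bar>t\<bar> < 1"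
  shows "((\<lambda>t. real p * \<beta> * t ^ (p - 1) - artanh t) has_real_derivative
           real (p * (p - 1)) * \<beta> * t ^ (p - 2) - 1 / (1 - t\<^sup>2)) (at t)"
proof -
  have "p - 2 = p - 1 - 1" by simp
  then show ?thesis
    using assms by (auto intro!: derivative_eq_intros simp: numeral_2_eq_2)
qed

lemma deriv_deriv_cw_g:
  assumes "\<bar>t\<bar> < 1"
  shows "deriv (deriv (cw_g \<beta> p)) t = real (p * (p - 1)) * \<beta> * t ^ (p - 2) - 1 / (1 - t\<^sup>2)"
proof -
  have "eventually (\<lambda>s. deriv (cw_g \<beta> p) s = real p * \<beta> * s ^ (p - 1) - artanh s) (nhds t)"
    using assms
    by (intro eventually_mono[OF eventually_nhds_in_open[of "{-1<..<1}"]])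
       (auto intro!: DERIV_imp_deriv[OF cw_g_has_real_derivative, simplified])
  then have "deriv (deriv (cw_g \<beta> p)) t = deriv (\<lambda>s. real p * \<beta> * s ^ (p - 1) - artanh s) t"
    by (intro deriv_cong_ev) auto
  then show ?thesis
    using DERIV_imp_deriv[OF cw_g_has_second_derivative[OF assms]] by simp
qed

lemma cw_g_0: "p > 0 \<Longrightarrow> cw_g \<beta> p 0 = 0"
  by (simp add: cw_g_def)

text \<open>Moves a maximizer on [-1,1] to the nonnegative side: the entropy is even, and the power
  term cannot decrease, whatever the parity of \<open>p\<close>.\<close>

lemma cw_g_le_abs:
  assumes "\<beta> \<ge> 0"
  shows "cw_g \<beta> p t \<le> cw_g \<beta> p \<bar>t\<bar>"
proof -
  have "t ^ p \<le> \<bar>t\<bar> ^ p"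
    by (metis abs_ge_self power_abs)
  moreover have "cw_I \<bar>t\<bar> = cw_I t"
    by (cases "t \<ge> 0") auto
  ultimately show ?thesis
    using assms by (simp add: cw_g_def mult_left_mono)
qed

section \<open>Above the threshold: existence and nondegeneracy of the maximizer\<close>

text \<open>A real \<open>Sup\<close> says something only about a nonempty set that is bounded
  above. Evaluation at t = 1 bounds the set by \<open>cw_I 1\<close>, and 0 belongs to it because
  the entropy is nonnegative. If \<open>g\<close> were nowhere positive on [0,1], its supremum would
  be g(0) = 0, and \<open>\<beta>\<close> would be in the set whose supremum it exceeds.\<close>

lemma cw_beta_star_props:
  assumes "p \<ge> 2" "\<beta> > cw_beta_star p"
  shows "\<beta> > 0" "\<exists>t\<in>{0..1}. cw_g \<beta> p t > 0"
proof -
  let ?B = "{\<beta>::real. \<beta> \<ge> 0 \<and> (SUP t\<in>{0..1}. \<beta> * t ^ p - cw_I t) = 0}"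
  have bdd_g: "bdd_above ((\<lambda>t. b * t ^ p - cw_I t) ` {0..1})" for b
  proof -
    have "continuous_on {0..1} (cw_g b p)"
      by (rule continuous_on_subset[OF continuous_on_cw_g]) auto
    then have "compact (cw_g b p ` {0..1})"
      by (intro compact_continuous_image) auto
    then show ?thesis
      unfolding cw_g_def[abs_def] by (intro bounded_imp_bdd_above compact_imp_bounded)
  qed
  have bdd: "bdd_above ?B"
  proof (rule bdd_aboveI)
    fix b assume b: "b \<in> ?B"
    have "b * 1 ^ p - cw_I 1 \<le> (SUP t\<in>{0..1}. b * t ^ p - cw_I t)"
      by (rule cSUP_upper[OF _ bdd_g]) auto
    with b show "b \<le> cw_I 1" by simp
  qed
  have I_nonneg: "cw_I t \<ge> 0" if t: "t \<in> {0..1}" for t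
  proof (cases "t = 1")
    case True
    then show ?thesis by (simp add: cw_I_def xlogx_def)
  next
    case False
    \<comment> \<open>At inverse temperature 0 the function \<open>cw_g\<close> is minus the
      entropy, so its derivative formula also serves for the entropy.\<close>
    have "cw_g 0 p t \<le> cw_g 0 p 0"
    proof (rule DERIV_nonpos_imp_decreasing_open[of 0 t "cw_g 0 p"])
      fix s assume s: "0 < s" "s < t"
      have "s < 1" using s t by auto
      have "artanh s \<ge> 0"
      proof -
        have "ln ((1 + s) / (1 - s)) \<ge> 0"
          using s \<open>s < 1\<close> by (intro ln_ge_zero) (simp add: field_simps)
        then show ?thesis by (simp add: artanh_def)
      qed
      then show "\<exists>y. (cw_g 0 p has_real_derivative y) (at s) \<and> y \<le> 0"
        using cw_g_has_real_derivative[of s 0 p] s t by force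
    qed (use t in \<open>auto intro: continuous_on_subset[OF continuous_on_cw_g]\<close>)
    then show ?thesis by (simp add: cw_g_def)
  qed
  have "0 \<in> ?B"
  proof -
    have "(SUP t\<in>{0..1}. - cw_I t) \<le> 0"
      by (rule cSUP_least) (auto intro: I_nonneg)
    moreover have "- cw_I 0 \<le> (SUP t\<in>{0..1}. - cw_I t)"
      using bdd_g[of 0] by (intro cSUP_upper) auto
    ultimately show ?thesis by simp
  qed
  then have "0 \<le> cw_beta_star p"
    unfolding cw_beta_star_def by (rule cSup_upper[OF _ bdd])
  with assms show "\<beta> > 0" by simp
  show "\<exists>t\<in>{0..1}. cw_g \<beta> p t > 0"
  proof (rule ccontr)
    assume "\<not> ?thesis"
    then have *: "\<beta> * t ^ p - cw_I t \<le> 0" if "t \<in> {0..1}" for t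
      using that by (force simp: cw_g_def)
    have "(SUP t\<in>{0..1}. \<beta> * t ^ p - cw_I t) \<le> 0"
      by (rule cSUP_least) (use * in auto)
    moreover have "\<beta> * 0 ^ p - cw_I 0 \<le> (SUP t\<in>{0..1}. \<beta> * t ^ p - cw_I t)"
      by (rule cSUP_upper[OF _ bdd_g]) auto
    ultimately have "\<beta> \<in> ?B"
      using \<open>\<beta> > 0\<close> assms(1) by (auto intro: antisym simp: power_0_left)
    then have "\<beta> \<le> cw_beta_star p"
      unfolding cw_beta_star_def by (rule cSup_upper[OF _ bdd])
    with assms show False by simp
  qed
qed

text \<open>The derivative has the sign of n - (n + 2) s^2, which can only pass from positive to
  negative as s > 0 grows. A dip at \<open>b\<close> would require a negative derivative before
  \<open>b\<close> and a positive one after it.\<close>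

lemma power_times_one_minus_square_quasiconcave:
  fixes a b t :: real
  assumes "0 < a" "a < b" "b < t"
  shows "min (a ^ n * (1 - a\<^sup>2)) (t ^ n * (1 - t\<^sup>2)) \<le> b ^ n * (1 - b\<^sup>2)"
proof (rule ccontr)
  assume *: "\<not> ?thesis"
  let ?f = "\<lambda>s::real. s ^ n * (1 - s\<^sup>2)"
  let ?f' = "\<lambda>s::real. real n * s ^ (n - 1) * (1 - s\<^sup>2) - 2 * s * s ^ n"
  have der: "(?f has_real_derivative ?f' s) (at s)" for s
    by (auto intro!: derivative_eq_intros)
  obtain y where y: "a < y" "y < b" "?f b - ?f a = (b - a) * ?f' y"
    using MVT2[of a b ?f ?f'] der assms by auto
  obtain z where z: "b < z" "z < t" "?f t - ?f b = (t - b) * ?f' z"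
    using MVT2[of b t ?f ?f'] der assms by auto
  have "(b - a) * ?f' y < 0"
    using * y(3) by (auto simp: min_def split: if_splits)
  then have fy: "?f' y < 0"
    using assms by (simp add: mult_less_0_iff)
  have "(t - b) * ?f' z > 0"
    using * z(3) by (auto simp: min_def split: if_splits)
  then have fz: "?f' z > 0"
    using assms by (simp add: zero_less_mult_iff)
  \<comment> \<open>The extra factor \<open>s\<close> absorbs the truncated exponent
    \<open>n - 1\<close>, so that n = 0 fits the same formula.\<close>
  have factor: "s * ?f' s = s ^ n * (real n - real (n + 2) * s\<^sup>2)" for s
    by (cases n) (simp_all add: algebra_simps power2_eq_square)
  have pos: "0 < y" "0 < z"
    using assms y z by auto
  have "y ^ n * (real n - real (n + 2) * y\<^sup>2) < 0"
    using fy pos factor[of y] by (metis mult_pos_neg)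
  then have "real n < real (n + 2) * y\<^sup>2"
    using pos by (simp add: mult_less_0_iff)
  also have "\<dots> \<le> real (n + 2) * z\<^sup>2"
    using pos y z by (intro mult_left_mono power_mono) auto
  finally have "z ^ n * (real n - real (n + 2) * z\<^sup>2) < 0"
    using pos by (simp add: mult_less_0_iff)
  with fz pos factor[of z] show False
    by (metis mult_pos_pos not_less_iff_gr_or_eq)
qed

text \<open>The threshold condition enters only through \<open>g_m_pos\<close>. Being a locale, it
  can be interpreted at a second maximizer, which is how uniqueness is proved.\<close>

locale cw_maximizer =
  fixes p :: nat and \<beta> m :: real
  assumes p_ge_2: "p \<ge> 2" and beta_pos: "\<beta> > 0"
    and m_pos: "0 < m" and m_le_1: "m \<le> 1"
    and max: "t \<in> {-1..1} \<Longrightarrow> cw_g \<beta> p t \<le> cw_g \<beta> p m"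
    and g_m_pos: "cw_g \<beta> p m > 0"
begin

abbreviation g where "g \<equiv> cw_g \<beta> p"
definition g' where "g' t = real p * \<beta> * t ^ (p - 1) - artanh t"
definition g'' where "g'' t = real (p * (p - 1)) * \<beta> * t ^ (p - 2) - 1 / (1 - t\<^sup>2)"

lemma g_deriv: "\<bar>t\<bar> < 1 \<Longrightarrow> (g has_real_derivative g' t) (at t)"
  unfolding g'_def by (rule cw_g_has_real_derivative)

lemma g'_deriv: "\<bar>t\<bar> < 1 \<Longrightarrow> (g' has_real_derivative g'' t) (at t)"
  unfolding g'_def[abs_def] g''_def by (rule cw_g_has_second_derivative)

text \<open>The entropy has infinite slope at 1: \<open>artanh\<close> exceeds the bounded term of
  \<open>g'\<close> there, so \<open>g\<close> strictly decreases just before 1.\<close>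

lemma m_less_1: "m < 1"
proof (rule ccontr)
  assume "\<not> m < 1"
  then have [simp]: "m = 1" using m_le_1 by simp
  have "eventually (\<lambda>t::real. artanh t > real p * \<beta>) (at_left 1)"
    using artanh_real_at_left_1 filterlim_at_top_dense by blast
  then obtain b where b: "b < 1" "\<And>t. b < t \<Longrightarrow> t < 1 \<Longrightarrow> artanh t > real p * \<beta>"
    by (auto simp: eventually_at_left[of 0])
  define a where "a = Max {b, 0}"
  have a: "0 \<le> a" "a < 1" "b \<le> a" using b by (auto simp: a_def)
  have "g 1 < g a"
  proof (rule DERIV_neg_imp_decreasing_open[OF \<open>a < 1\<close>])
    fix t assume t: "a < t" "t < 1"
    have "t ^ (p - 1) \<le> 1"
      using t a by (intro power_le_one) auto
    then have "real p * \<beta> * t ^ (p - 1) \<le> real p * \<beta>"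
      using beta_pos by (simp add: mult_left_le)
    also have "\<dots> < artanh t"
      using b t a by auto
    finally have "g' t < 0" by (simp add: g'_def)
    then show "\<exists>y. (g has_real_derivative y) (at t) \<and> y < 0"
      using g_deriv[of t] t a by auto
  qed (use a in \<open>auto intro: continuous_on_subset[OF continuous_on_cw_g]\<close>)
  with max[of a] a show False by simp
qed

lemma g'_m: "g' m = 0"
proof (rule DERIV_local_max)
  show "(g has_real_derivative g' m) (at m)"
    using g_deriv m_pos m_less_1 by simp
  show "0 < min m (1 - m)"
    using m_pos m_less_1 by simp
  show "\<forall>y. \<bar>m - y\<bar> < min m (1 - m) \<longrightarrow> g y \<le> g m"
    using max by (auto simp: abs_if split: if_splits)
qed

text \<open>At \<open>t = m\<close> this is the nondegeneracy behind the Gaussian limit; the range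
  up to 1 is what uniqueness needs.\<close>

lemma g''_neg:
  assumes t: "m \<le> t" "t < 1"
  shows "g'' t < 0"
proof (rule ccontr)
  assume ge: "\<not> g'' t < 0"
  define C where "C = real (p * (p - 1)) * \<beta>"
  let ?f = "\<lambda>s::real. s ^ (p - 2) * (1 - s\<^sup>2)"
  have sq: "1 - s\<^sup>2 > 0" if "0 < s" "s < 1" for s :: real
    using that by (simp add: power_less_one_iff)
  have C: "C > 0"
    using p_ge_2 beta_pos by (simp add: C_def)
  have eq: "g'' s = (C * ?f s - 1) / (1 - s\<^sup>2)" if "0 < s" "s < 1" for s
    using sq[OF that] by (simp add: g''_def C_def field_simps)
  txt \<open>\<open>g''\<close> would be positive, negative and nonnegative at some \<open>a < b < t\<close>, but its sign is that of a
    quasiconcave function.\<close>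
  obtain x where x: "0 < x" "x < m" "g m - g 0 = (m - 0) * g' x"
    using MVT2[of 0 m g g'] m_pos m_less_1 g_deriv by auto
  have "g' x > 0"
    using x g_m_pos p_ge_2 m_pos by (simp add: cw_g_0 zero_less_mult_iff)
  have "g' 0 = 0" using p_ge_2 by (simp add: g'_def)
  obtain a where a: "0 < a" "a < x" "g' x - g' 0 = (x - 0) * g'' a"
    using MVT2[of 0 x g' g''] x m_less_1 g'_deriv by auto
  obtain b where b: "x < b" "b < m" "g' m - g' x = (m - x) * g'' b"
    using MVT2[of x m g' g''] x m_less_1 g'_deriv by auto
  have "g'' a > 0"
    using a \<open>g' x > 0\<close> \<open>g' 0 = 0\<close> by (simp add: zero_less_mult_iff)
  then have fa: "C * ?f a > 1"
    using eq[of a] sq[of a] a x m_less_1 by (simp add: zero_less_divide_iff)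
  have "(m - x) * g'' b < 0"
    using b \<open>g' x > 0\<close> g'_m by simp
  then have "g'' b < 0"
    using x by (simp add: mult_less_0_iff)
  then have fb: "C * ?f b < 1"
    using eq[of b] sq[of b] b x m_less_1 by (simp add: divide_less_0_iff)
  have ft: "C * ?f t \<ge> 1"
    using ge eq[of t] sq[of t] t m_pos by (simp add: not_less zero_le_divide_iff)
  have "min (?f a) (?f t) \<le> ?f b"
    by (rule power_times_one_minus_square_quasiconcave) (use a b x t in auto)
  then have "C * min (?f a) (?f t) \<le> C * ?f b"
    using C by (intro mult_left_mono) auto
  with fa fb ft show False
    by (auto simp: min_def split: if_splits)
qed

text \<open>The point \<open>s\<close> satisfies the locale assumptions too. Of two distinct
  maximizers, both are zeros of \<open>g'\<close>, yet \<open>g'\<close> is strictly decreasing from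
  the smaller one on.\<close>

lemma maximizer_unique:
  assumes s: "0 \<le> s" "s \<le> 1" and eq: "g s = g m"
  shows "s = m"
proof -
  have s0: "0 < s"
    using s eq g_m_pos p_ge_2 cw_g_0[of p \<beta>] by (cases "s = 0") auto
  interpret s: cw_maximizer p \<beta> s
    by unfold_locales (use p_ge_2 beta_pos s0 s max g_m_pos eq in auto)
  have contr: False if "a < b" "b < 1" "cw_maximizer p \<beta> a" "cw_maximizer p \<beta> b" for a b
  proof -
    interpret a: cw_maximizer p \<beta> a by fact
    interpret b: cw_maximizer p \<beta> b by fact
    obtain z where z: "a < z" "z < b" "g' b - g' a = (b - a) * g'' z"
    proof -
      have "(g' has_real_derivative g'' t) (at t)" if "a \<le> t" "t \<le> b" for t
        using that \<open>b < 1\<close> a.m_pos by (intro g'_deriv) auto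
      then show ?thesis
        using MVT2[of a b g' g''] that \<open>a < b\<close> by blast
    qed
    have "g'' z < 0"
      using a.g''_neg[of z] z that by simp
    with z that a.g'_m b.g'_m show False by simp
  qed
  show ?thesis
    using contr[of s m] contr[of m s] s.m_less_1 m_less_1 s.cw_maximizer_axioms cw_maximizer_axioms
    by argo
qed

text \<open>The remainder is packed into a factor continuous at \<open>m\<close>, which can be
  composed with any sequence tending to \<open>m\<close>. Its value there comes from L'Hopital's
  rule and g'(m) = 0.\<close>

lemma second_order_expansion:
  obtains r where "\<And>t. g t - g m = r t * (t - m)\<^sup>2" "isCont r m" "r m = g'' m / 2"
proof -
  define r where "r t = (if t = m then g'' m / 2 else (g t - g m) / (t - m)\<^sup>2)" for t
  have near: "eventually (\<lambda>t. \<bar>t\<bar> < 1) (at m)"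
    using m_pos m_less_1
    by (intro eventually_mono[OF eventually_at_in_open'[of "{-1<..<1}"]]) auto
  have "((\<lambda>t. (g' t - g' m) / (t - m)) \<longlongrightarrow> g'' m) (at m)"
    using g'_deriv[of m] m_pos m_less_1 by (simp add: has_field_derivative_iff)
  then have "((\<lambda>t. (g' t - g' m) / (t - m) / 2) \<longlongrightarrow> g'' m / 2) (at m)"
    by (intro tendsto_intros) auto
  then have lim': "((\<lambda>t. g' t / (2 * (t - m))) \<longlongrightarrow> g'' m / 2) (at m)"
    by (simp add: g'_m field_simps)
  have cont: "isCont g m"
    using g_deriv[of m] m_pos m_less_1 DERIV_isCont by auto
  have "((\<lambda>t. (g t - g m) / (t - m)\<^sup>2) \<longlongrightarrow> g'' m / 2) (at m)"
  proof (rule lhopital[OF _ _ _ _ _ _ lim'])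
    show "(\<lambda>t. g t - g m) \<midarrow>m\<rightarrow> 0"
      using cont by (auto simp: isCont_def LIM_zero_iff)
    show "(\<lambda>t. (t - m)\<^sup>2) \<midarrow>m\<rightarrow> 0"
      by (auto intro!: tendsto_eq_intros)
    show "\<forall>\<^sub>F t in at m. ((\<lambda>t. g t - g m) has_real_derivative g' t) (at t)"
      using near by eventually_elim (auto intro!: derivative_eq_intros g_deriv)
    show "\<forall>\<^sub>F t in at m. ((\<lambda>t. (t - m)\<^sup>2) has_real_derivative 2 * (t - m)) (at t)"
      by (auto intro!: always_eventually derivative_eq_intros)
  qed (auto simp: eventually_at_filter)
  then have "(r \<longlongrightarrow> g'' m / 2) (at m)"
    by (rule Lim_transform_eventually) (auto simp: r_def eventually_at_filter)
  then have "isCont r m" by (simp add: isCont_def r_def)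
  then show ?thesis
    by (intro that[of r]) (auto simp: r_def)
qed

text \<open>This is the source of the dominating Gaussian. Near \<open>m\<close> the expansion gives
  the bound with g''(m) / 4, which lies strictly between the limit g''(m) / 2 and 0. Away from
  \<open>m\<close>, compactness and uniqueness give a gap \<open>e\<close>, and (t - m)^2 \<le> 1
  turns this gap into a quadratic bound.\<close>

lemma quadratic_upper_bound:
  obtains c where "c > 0" "\<And>t. t \<in> {0..1} \<Longrightarrow> g t - g m \<le> - c * (t - m)\<^sup>2"
proof -
  obtain r where r: "\<And>t. g t - g m = r t * (t - m)\<^sup>2" "isCont r m" "r m = g'' m / 2"
    using second_order_expansion by blast
  have neg: "g'' m < 0"
    using g''_neg m_less_1 by simp
  have "(r \<longlongrightarrow> r m) (nhds m)"
    using r(2) by (simp add: isCont_def tendsto_at_iff_tendsto_nhds)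
  then have "eventually (\<lambda>t. r t < g'' m / 4) (nhds m)"
    by (rule order_tendstoD) (use r(3) neg in simp)
  then obtain d where d: "d > 0" "\<And>t. \<bar>t - m\<bar> < d \<Longrightarrow> r t < g'' m / 4"
    by (auto simp: eventually_nhds_metric dist_real_def)
  define A where "A = {0..1} - ball m d"
  have "\<exists>e>0. \<forall>t\<in>A. g t \<le> g m - e"
  proof (cases "A = {}")
    case True
    then show ?thesis by (auto intro: exI[of _ 1])
  next
    case False
    have "compact A" unfolding A_def by (intro compact_diff) auto
    moreover have "continuous_on A g"
      by (rule continuous_on_subset[OF continuous_on_cw_g]) (auto simp: A_def)
    ultimately obtain s where s: "s \<in> A" "\<And>t. t \<in> A \<Longrightarrow> g t \<le> g s"
      using False continuous_attains_sup by metis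
    have "s \<noteq> m" using s d by (auto simp: A_def)
    then have "g s < g m"
      using max[of s] maximizer_unique[of s] s(1) by (force simp: A_def)
    then show ?thesis
      using s by (intro exI[of _ "g m - g s"]) auto
  qed
  then obtain e where e: "e > 0" "\<And>t. t \<in> A \<Longrightarrow> g t \<le> g m - e"
    by auto
  define c where "c = min e (- g'' m / 4)"
  show ?thesis
  proof (rule that[of c])
    show "c > 0" using e neg by (simp add: c_def)
    fix t :: real assume t: "t \<in> {0..1}"
    show "g t - g m \<le> - c * (t - m)\<^sup>2"
    proof (cases "\<bar>t - m\<bar> < d")
      case True
      have "r t \<le> - c"
        using d(2)[OF True] by (simp add: c_def)
      then show ?thesis
        unfolding r by (intro mult_right_mono) auto
    next
      case False
      then have "t \<in> A"
        using t by (auto simp: A_def dist_real_def abs_minus_commute)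
      then have "g t - g m \<le> - e"
        using e by force
      also have "(t - m)\<^sup>2 \<le> 1"
        using t m_pos m_less_1 by (intro power2_le_iff_abs_le[THEN iffD2, of 1, simplified]) (auto simp: abs_le_iff)
      then have "- e \<le> - c * (t - m)\<^sup>2"
        using \<open>c > 0\<close> mult_left_mono[of "(t - m)\<^sup>2" 1 c] by (simp add: c_def)
      finally show ?thesis .
    qed
  qed
qed

end

lemma cw_maximizer_exists:
  assumes "p \<ge> 2" "\<beta> > cw_beta_star p"
  obtains m where "cw_maximizer p \<beta> m"
proof -
  note b = cw_beta_star_props[OF assms]
  obtain s where s: "s \<in> {-1..1}" "\<And>t. t \<in> {-1..1} \<Longrightarrow> cw_g \<beta> p t \<le> cw_g \<beta> p s"
    using continuous_attains_sup[OF _ _ continuous_on_cw_g, of \<beta> p] by auto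
  obtain t where t: "t \<in> {0..1}" "cw_g \<beta> p t > 0"
    using b by auto
  have le: "cw_g \<beta> p s \<le> cw_g \<beta> p \<bar>s\<bar>"
    using b by (intro cw_g_le_abs) auto
  have pos: "cw_g \<beta> p \<bar>s\<bar> > 0"
    using t s(2)[of t] le by auto
  have "s \<noteq> 0"
    using pos assms cw_g_0[of p \<beta>] by auto
  show ?thesis
    by (rule that[of "\<bar>s\<bar>"], unfold_locales)
       (use assms b s le pos \<open>s \<noteq> 0\<close> in \<open>force+\<close>)
qed

subsection \<open>Reduction to the magnetization\<close>

lemma finite_cw_configs: "finite (cw_configs N)"
  unfolding cw_configs_def by (intro finite_PiE) auto

text \<open>A configuration is determined by its set of plus spins; if this set has \<open>k\<close>
  elements, the spins add up to 2k - N.\<close>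

lemma sum_cw_configs:
  "(\<Sum>X\<in>cw_configs N. f (\<Sum>i<N. X i)) =
     (\<Sum>k\<le>N. real (N choose k) * f (2 * real k - real N))"
proof -
  let ?h = "\<lambda>B. \<lambda>i\<in>{0..<N}. if i \<in> B then 1 else - 1 :: real"
  have bij: "bij_betw ?h (Pow {0..<N}) (cw_configs N)"
  proof (rule bij_betw_byWitness[where f' = "\<lambda>X. {i \<in> {0..<N}. X i = 1}"])
    show "\<forall>X\<in>cw_configs N. ?h {i \<in> {0..<N}. X i = 1} = X"
    proof
      fix X assume X: "X \<in> cw_configs N"
      then have "X i \<in> {-1, 1}" if "i < N" for i
        using that by (auto simp: cw_configs_def PiE_iff)
      moreover have "X i = undefined" if "\<not> i < N" for i
        using X that by (auto simp: cw_configs_def PiE_def extensional_def)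
      ultimately show "?h {i \<in> {0..<N}. X i = 1} = X"
        by (force simp: fun_eq_iff)
    qed
  qed (auto simp: cw_configs_def split: if_splits)
  have val: "(\<Sum>i<N. ?h B i) = 2 * real (card B) - real N" if "B \<in> Pow {0..<N}" for B
  proof -
    have "finite B" using that finite_subset by auto
    have "(\<Sum>i<N. ?h B i) = (\<Sum>i<N. 2 * indicator B i - 1)"
      by (intro sum.cong) (auto simp: indicator_def)
    also have "\<dots> = 2 * (\<Sum>i<N. indicator B i) - real N"
      by (simp add: sum_subtractf sum_distrib_left)
    also have "(\<Sum>i<N. indicator B i) = real (card ({..<N} \<inter> B))"
      by (simp add: indicator_def sum.If_cases)
    also have "{..<N} \<inter> B = B" using that by auto
    finally show ?thesis .
  qed
  have "(\<Sum>X\<in>cw_configs N. f (\<Sum>i<N. X i)) = (\<Sum>B\<in>Pow {0..<N}. f (\<Sum>i<N. ?h B i))"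
    using sum.reindex_bij_betw[OF bij, of "\<lambda>X. f (\<Sum>i<N. X i)"] by simp
  also have "\<dots> = (\<Sum>B\<in>Pow {0..<N}. f (2 * real (card B) - real N))"
    by (intro sum.cong refl arg_cong[of _ _ f] val)
  also have "\<dots> = (\<Sum>k\<in>{..N}. \<Sum>B\<in>{B \<in> Pow {0..<N}. card B = k}. f (2 * real (card B) - real N))"
    by (intro sum.group[symmetric])
       (auto simp: card_mono[of "{0..<N}", simplified])
  also have "\<dots> = (\<Sum>k\<le>N. real (N choose k) * f (2 * real k - real N))"
  proof (intro sum.cong refl)
    fix k
    have "(\<Sum>B\<in>{B \<in> Pow {0..<N}. card B = k}. f (2 * real (card B) - real N)) =
          real (card {B. B \<subseteq> {0..<N} \<and> card B = k}) * f (2 * real k - real N)"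
      by simp
    then show "(\<Sum>B\<in>{B \<in> Pow {0..<N}. card B = k}. f (2 * real (card B) - real N)) =
        real (N choose k) * f (2 * real k - real N)"
      by (simp add: n_subsets)
  qed
  finally show ?thesis .
qed

definition cw_mean :: "nat \<Rightarrow> (nat \<Rightarrow> real) \<Rightarrow> real" where
  "cw_mean N X = (\<Sum>i<N. X i) / real N"

lemma sum_PiE_prod_const:
  fixes X :: "'b \<Rightarrow> real"
  assumes "finite A" "finite B"
  shows "(\<Sum>ix\<in>PiE A (\<lambda>_. B). \<Prod>k\<in>A. X (ix k)) = (\<Sum>i\<in>B. X i) ^ card A"
  using prod_sum_PiE[of A "\<lambda>_. B" "\<lambda>_. X"] assms by simp

lemma cw_H_eq:
  assumes "N > 0" "p > 0"
  shows "cw_H p N X = real N * cw_mean N X ^ p"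
proof -
  have "cw_H p N X = cw_J p N * (\<Sum>i<N. X i) ^ p"
    using sum_PiE_prod_const[of "{0..<p}" "{0..<N}" X]
    by (simp add: cw_H_def lessThan_atLeast0 flip: sum_distrib_left)
  moreover have "real N ^ p = real N * real N ^ (p - 1)"
    using assms by (simp flip: power_Suc)
  ultimately show ?thesis
    using assms by (simp add: cw_J_def cw_mean_def power_divide)
qed

lemma cw_m_eq:
  assumes "N > 0"
  shows "cw_m p N X i = cw_mean N X ^ (p - 1)"
  using sum_PiE_prod_const[of "{1..<p}" "{0..<N}" X] assms
  by (simp add: cw_m_def cw_J_def cw_mean_def power_divide lessThan_atLeast0 flip: sum_divide_distrib)

text \<open>The pseudo-likelihood equation divided by \<open>N\<close>: all \<open>N\<close> local
  fields coincide, so the sum over sites is \<open>N\<close> times a single term.\<close>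

definition mean_mpl :: "nat \<Rightarrow> real \<Rightarrow> ereal" where
  "mean_mpl p t = Inf (ereal ` {b. b \<ge> 0 \<and> t ^ p = t ^ (p - 1) * tanh (real p * b * t ^ (p - 1))})"

lemma mpl_est_eq:
  assumes "N > 0" "p > 0"
  shows "mpl_est p N X = mean_mpl p (cw_mean N X)"
  using assms by (simp add: mpl_est_def mean_mpl_def cw_H_eq cw_m_eq)

lemma tanh_artanh_real:
  fixes t :: real
  assumes "\<bar>t\<bar> < 1"
  shows "tanh (artanh t) = t"
proof -
  have "exp (2 * artanh t) = (1 + t) / (1 - t)"
    using assms by (simp add: artanh_def)
  then have "exp (- 2 * artanh t) = (1 - t) / (1 + t)"
    by (simp add: exp_minus)
  then have "tanh (artanh t) = (1 - (1 - t) / (1 + t)) / (1 + (1 - t) / (1 + t))"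
    by (simp only: tanh_real_altdef)
  also have "\<dots> = t"
    using assms by (simp add: field_simps)
  finally show ?thesis .
qed

text \<open>For positive \<open>t\<close> the common power cancels and leaves tanh(...) = t.
  Injectivity of tanh makes the solution set a singleton, whose element is nonnegative.\<close>

lemma mean_mpl_pos:
  assumes "0 < t" "t < 1" "p > 0"
  shows "mean_mpl p t = ereal (artanh t / (real p * t ^ (p - 1)))"
proof -
  let ?b = "artanh t / (real p * t ^ (p - 1))"
  have "t ^ p = t ^ (p - 1) * t"
    using assms by (simp flip: power_Suc2)
  then have "t ^ p = t ^ (p - 1) * tanh x \<longleftrightarrow> tanh x = t" for x
    using assms by auto
  moreover have "tanh x = t \<longleftrightarrow> x = artanh t" for x
    using assms artanh_tanh_real[of x] tanh_artanh_real[of t] by auto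
  moreover have "real p * b * t ^ (p - 1) = artanh t \<longleftrightarrow> b = ?b" for b
    using assms by (auto simp: field_simps)
  moreover have "?b \<ge> 0"
  proof -
    have "ln ((1 + t) / (1 - t)) \<ge> 0"
      using assms by (intro ln_ge_zero) (simp add: field_simps)
    then show ?thesis
      using assms by (simp add: artanh_def)
  qed
  ultimately have "{b. b \<ge> 0 \<and> t ^ p = t ^ (p - 1) * tanh (real p * b * t ^ (p - 1))} = {?b}"
    by auto
  then show ?thesis
    by (simp add: mean_mpl_def)
qed

text \<open>The exponent p - 1 is odd, so the sign changes outside and inside tanh compensate each
  other, while t^p is unchanged.\<close>

lemma mean_mpl_minus:
  assumes "even p" "p > 0"
  shows "mean_mpl p (- t) = mean_mpl p t"
proof -
  have "odd (p - 1)" using assms by simp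
  then show ?thesis
    using assms by (simp add: mean_mpl_def)
qed

text \<open>For b \<ge> 0 the right-hand side of the equation is nonnegative and t^p is negative, so
  the infimum runs over the empty set.\<close>

lemma mean_mpl_neg:
  assumes "odd p" "t < 0"
  shows "mean_mpl p t = \<infinity>"
proof -
  have "{b. b \<ge> 0 \<and> t ^ p = t ^ (p - 1) * tanh (real p * b * t ^ (p - 1))} = {}"
  proof (intro equals0I; clarsimp)
    fix b :: real
    assume b: "0 \<le> b" "t ^ p = t ^ (p - Suc 0) * tanh (real p * b * t ^ (p - Suc 0))"
    have "t ^ (p - 1) > 0"
      using assms by (simp add: zero_less_power_eq)
    then have "t ^ (p - 1) * tanh (real p * b * t ^ (p - 1)) \<ge> 0"
      using b by simp
    moreover have "t ^ p < 0"
      using assms by (simp add: power_less_zero_eq)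
    ultimately show False using b by simp
  qed
  then show ?thesis
    unfolding mean_mpl_def by (simp only: image_empty Inf_empty top_ereal_def)
qed

subsection \<open>Stirling asymptotics of binomial coefficients\<close>

text \<open>The factor of order sqrt n in Stirling's formula. Since 0^0 = 1, its value at 0 is 1, so
  the entropy formula for binomials includes the endpoints.\<close>

definition stirling_factor :: "nat \<Rightarrow> real" where
  "stirling_factor n = fact n * exp (real n) / real n ^ n"

text \<open>Compare the exponential series at \<open>n\<close> with its single term n^n / n!. This
  crude bound serves near t = 1, where the number of minus spins may be small or zero.\<close>

lemma stirling_factor_ge_1: "stirling_factor n \<ge> 1"
proof -
  have "(\<Sum>k\<in>{n}. inverse (fact k) * real n ^ k) \<le> (\<Sum>k. inverse (fact k) * real n ^ k)"
    by (rule sum_le_suminf) (auto intro: summable_exp)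
  then have "real n ^ n / fact n \<le> exp (real n)"
    by (simp add: exp_def field_simps)
  then show ?thesis
    by (cases "n = 0") (simp_all add: stirling_factor_def field_simps)
qed

text \<open>The increments of the logarithm are O(1 / n^2), so the logarithm converges, and the
  limit is positive because it is an exponential.\<close>

lemma stirling_factor_asymp:
  obtains c where "c > 0" "(\<lambda>n. stirling_factor n / sqrt (real n)) \<longlonglongrightarrow> c"
proof -
  define a where "a n = ln (stirling_factor (Suc n) / sqrt (real (Suc n)))" for n
  have step: "a (Suc n) - a n = 1 - (real n + 3/2) * (ln (real n + 2) - ln (real n + 1))" for n
  proof -
    have "ln (stirling_factor k / sqrt (real k)) = ln (fact k) + real k - real k * ln (real k) - ln (real k) / 2"
      if "k > 0" for k
      using that by (simp add: stirling_factor_def ln_mult ln_div ln_realpow ln_sqrt)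
    then have a_eq: "a n = ln (fact (Suc n)) + real (Suc n) - real (Suc n) * ln (real (Suc n)) - ln (real (Suc n)) / 2" for n
      unfolding a_def by blast
    moreover have "ln (fact (Suc (Suc n))) = ln (real n + 2) + ln (fact (Suc n) :: real)"
      unfolding fact_Suc[of "Suc n"] by (subst ln_mult) (auto simp: add_ac)
    ultimately show ?thesis
      unfolding a_eq by (simp add: field_simps del: fact_Suc)
  qed
  have "summable (\<lambda>n. a (Suc n) - a n)"
  proof (rule summable_comparison_test_bigo)
    show "summable (\<lambda>n. norm (1 / real n ^ 2))"
      using inverse_power_summable[of 2, where ?'a = real] by (simp add: field_simps)
    show "(\<lambda>n. a (Suc n) - a n) \<in> O(\<lambda>n. 1 / real n ^ 2)"
      unfolding step by real_asymp
  qed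
  then have "convergent (\<lambda>n. \<Sum>k<n. a (Suc k) - a k)"
    by (simp add: summable_iff_convergent)
  then have "convergent (\<lambda>n. a n - a 0)"
    by (simp add: sum_lessThan_telescope)
  then obtain l where "(\<lambda>n. a n - a 0) \<longlonglongrightarrow> l"
    by (auto simp: convergent_def)
  then have "(\<lambda>n. exp (a n - a 0 + a 0)) \<longlonglongrightarrow> exp (l + a 0)"
    by (intro tendsto_intros)
  moreover have "exp (a n) = stirling_factor (Suc n) / sqrt (real (Suc n))" for n
    using stirling_factor_ge_1[of "Suc n"] by (simp add: a_def)
  ultimately have "(\<lambda>n. stirling_factor (Suc n) / sqrt (real (Suc n))) \<longlonglongrightarrow> exp (l + a 0)"
    by simp
  then have "(\<lambda>n. stirling_factor n / sqrt (real n)) \<longlonglongrightarrow> exp (l + a 0)"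
    by (rule LIMSEQ_imp_Suc)
  then show ?thesis
    by (intro that[of "exp (l + a 0)"]) auto
qed

text \<open>A positive sequence with positive limit is bounded, and so is its inverse. At n = 0 the
  lower bound reads 0 \<le> 1, whereas the upper one would fail.\<close>

lemma stirling_factor_bounds:
  obtains a b where "a > 0" "b > 0" "\<And>n. a * sqrt (real n) \<le> stirling_factor n"
    "\<And>n. n > 0 \<Longrightarrow> stirling_factor n \<le> b * sqrt (real n)"
proof -
  obtain c where c: "c > 0" "(\<lambda>n. stirling_factor n / sqrt (real n)) \<longlonglongrightarrow> c"
    using stirling_factor_asymp .
  have pos: "stirling_factor n > 0" for n
    using stirling_factor_ge_1[of n] by simp
  have "Bseq (\<lambda>n. stirling_factor n / sqrt (real n))"
    using c by (intro convergent_imp_Bseq) (auto simp: convergent_def)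
  then obtain b where b: "b > 0" "\<And>n. norm (stirling_factor n / sqrt (real n)) \<le> b"
    by (auto simp: Bseq_def)
  have "Bseq (\<lambda>n. inverse (stirling_factor n / sqrt (real n)))"
    using tendsto_inverse[OF c(2)] c(1) by (intro convergent_imp_Bseq) (auto simp: convergent_def)
  then obtain a where a: "a > 0" "\<And>n. norm (inverse (stirling_factor n / sqrt (real n))) \<le> a"
    by (auto simp: Bseq_def)
  show ?thesis
  proof (rule that[of "inverse a" b])
    show "inverse a * sqrt (real n) \<le> stirling_factor n" for n
      using a(1) a(2)[of n] pos[of n] by (simp add: field_simps)
    show "stirling_factor n \<le> b * sqrt (real n)" if "n > 0" for n
      using b(2)[of n] pos[of n] that by (simp add: field_simps)
  qed (use a b in auto)
qed

lemma mult_ln_divide: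
  assumes "n > 0"
  shows "exp (real k * ln (real k / real n)) = real k ^ k / real n ^ k"
  using assms by (cases "k = 0") (simp_all add: exp_of_nat_mult power_divide)

text \<open>An exact identity: the power terms of the three Stirling factors combine to
  \<open>q\<close>, the exponentials cancel because k + (n - k) = n, and exp(n I) = 2^n q.\<close>

lemma binomial_entropy:
  assumes "k \<le> n" "n > 0"
  shows "real (n choose k) / 2 ^ n =
    stirling_factor n / (stirling_factor k * stirling_factor (n - k)) * exp (- real n * cw_I (2 * real k / real n - 1))"
proof -
  define t where "t = 2 * real k / real n - 1"
  define q where "q = real k ^ k * real (n - k) ^ (n - k) / real n ^ n"
  have xlogx: "real n / 2 * xlogx (2 * real j / real n) = real j * ln (real j / real n) + real j * ln 2" for j
    using assms by (cases "j = 0") (simp_all add: xlogx_def ln_mult ln_div field_simps)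
  have "1 + t = 2 * real k / real n" "1 - t = 2 * real (n - k) / real n"
    using assms by (auto simp: t_def field_simps of_nat_diff)
  then have "real n * cw_I t = real n / 2 * xlogx (2 * real k / real n) + real n / 2 * xlogx (2 * real (n - k) / real n)"
    unfolding cw_I_def by (simp only: distrib_left add_divide_distrib times_divide_eq_right times_divide_eq_left)
  also have "\<dots> = real k * ln (real k / real n) + real (n - k) * ln (real (n - k) / real n) + real n * ln 2"
    unfolding xlogx using assms by (simp add: of_nat_diff algebra_simps)
  finally have "exp (real n * cw_I t) =
      exp (real k * ln (real k / real n)) * exp (real (n - k) * ln (real (n - k) / real n)) * exp (real n * ln 2)"
    by (simp add: exp_add)
  also have "\<dots> = real k ^ k * real (n - k) ^ (n - k) / real n ^ n * 2 ^ n"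
    unfolding mult_ln_divide[OF assms(2)] using assms
    by (simp add: exp_of_nat_mult flip: power_add)
  finally have E: "exp (real n * cw_I t) = q * 2 ^ n"
    by (simp add: q_def)
  have "exp (real n) = exp (real k) * exp (real (n - k))"
    using assms by (simp flip: exp_add)
  then have "stirling_factor n / (stirling_factor k * stirling_factor (n - k)) = real (n choose k) * q"
    using assms by (simp add: stirling_factor_def binomial_fact q_def field_simps)
  moreover have "exp (- real n * cw_I t) = 1 / (q * 2 ^ n)"
    using E by (simp add: exp_minus inverse_eq_divide)
  moreover have "q \<noteq> 0"
    using assms by (auto simp: q_def)
  ultimately show ?thesis
    unfolding t_def[symmetric] by simp
qed

subsection \<open>Local limit of the weights\<close>

lemma integrable_gaussian:
  assumes "(c::real) > 0"
  shows "integrable lborel (\<lambda>u::real. exp (- c * u\<^sup>2))"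
proof -
  define s where "s = 1 / sqrt (2 * c)"
  have "s > 0" "s\<^sup>2 = 1 / (2 * c)"
    using assms by (auto simp: s_def power_divide)
  then have "exp (- c * u\<^sup>2) = sqrt (2 * pi * s\<^sup>2) * normal_density 0 s u" for u
    using assms by (simp add: normal_density_def)
  then show ?thesis
    using \<open>s > 0\<close> by simp
qed

lemma integral_step_function:
  fixes a x :: "nat \<Rightarrow> real" and h :: real
  assumes "finite A" "h \<ge> 0"
  shows "(\<integral>u. (\<Sum>k\<in>A. a k * indicator {x k..<x k + h} u) \<partial>lborel) = h * (\<Sum>k\<in>A. a k)"
proof -
  have "has_bochner_integral lborel (\<lambda>u. \<Sum>k\<in>A. a k * indicator {x k..<x k + h} u) (\<Sum>k\<in>A. a k * h)"
  proof (intro has_bochner_integral_sum has_bochner_integral_mult_right)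
    fix k
    have "has_bochner_integral lborel (indicator {x k..<x k + h} :: real \<Rightarrow> real)
            (measure lborel {x k..<x k + h})"
      by (rule has_bochner_integral_real_indicator) (use assms in auto)
    then show "has_bochner_integral lborel (indicator {x k..<x k + h} :: real \<Rightarrow> real) h"
      using assms by simp
  qed
  then show ?thesis
    by (simp add: has_bochner_integral_integral_eq sum_distrib_left mult.commute)
qed

text \<open>The magnetization with \<open>k\<close> plus spins. Neighbouring values differ by 2 / N,
  hence by 2 / sqrt N after rescaling; this is the width of the steps below.\<close>

definition mag :: "nat \<Rightarrow> nat \<Rightarrow> real" where
  "mag N k = 2 * real k / real N - 1"

context cw_maximizer
begin

text \<open>The denominator does not depend on \<open>k\<close>, so it cancels in probabilities; it
  is chosen so that the total weight has a finite positive limit.\<close>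

definition weight :: "nat \<Rightarrow> nat \<Rightarrow> real" where
  "weight N k = real (N choose k) * exp (real N * \<beta> * mag N k ^ p) / (2 ^ N * exp (real N * g m))"

lemma weight_nonneg: "weight N k \<ge> 0"
  by (simp add: weight_def)

lemma weight_eq:
  assumes "k \<le> N" "N > 0"
  shows "weight N k = stirling_factor N / (stirling_factor k * stirling_factor (N - k)) *
           exp (real N * (g (mag N k) - g m))"
proof -
  have "weight N k = real (N choose k) / 2 ^ N * exp (real N * \<beta> * mag N k ^ p) / exp (real N * g m)"
    by (simp add: weight_def)
  also have "\<dots> = stirling_factor N / (stirling_factor k * stirling_factor (N - k)) *
      (exp (- real N * cw_I (mag N k)) * exp (real N * \<beta> * mag N k ^ p) / exp (real N * g m))"
    unfolding binomial_entropy[OF assms] mag_def by simp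
  also have "exp (- real N * cw_I (mag N k)) * exp (real N * \<beta> * mag N k ^ p) / exp (real N * g m) =
      exp (real N * (g (mag N k) - g m))"
    unfolding cw_g_def by (simp add: algebra_simps flip: exp_add exp_diff)
  finally show ?thesis .
qed

lemma mag_tendsto:
  assumes "(\<lambda>N. sqrt (real N) * (mag N (k N) - m)) \<longlonglongrightarrow> u"
  shows "(\<lambda>N. mag N (k N)) \<longlonglongrightarrow> m"
proof -
  have "(\<lambda>N. 1 / sqrt (real N)) \<longlonglongrightarrow> 0"
    by real_asymp
  with assms have "(\<lambda>N. sqrt (real N) * (mag N (k N) - m) * (1 / sqrt (real N))) \<longlonglongrightarrow> u * 0"
    by (intro tendsto_intros)
  moreover have "\<forall>\<^sub>F N in sequentially. sqrt (real N) * (mag N (k N) - m) * (1 / sqrt (real N)) = mag N (k N) - m"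
    using eventually_gt_at_top[of 0] by eventually_elim simp
  ultimately have "(\<lambda>N. mag N (k N) - m) \<longlonglongrightarrow> u * 0"
    by (rule Lim_transform_eventually)
  then show ?thesis by (simp add: LIM_zero_iff)
qed

lemma mag_eventually:
  assumes "(\<lambda>N. mag N (k N)) \<longlonglongrightarrow> m"
  shows "\<forall>\<^sub>F N in sequentially. 0 < N \<and> 0 < mag N (k N) \<and> mag N (k N) < 1 \<and> k N < N \<and> N < 2 * k N"
proof -
  have "\<forall>\<^sub>F N in sequentially. mag N (k N) > 0" "\<forall>\<^sub>F N in sequentially. mag N (k N) < 1"
    using order_tendstoD[OF assms] m_pos m_less_1 by auto
  then show ?thesis
    using eventually_gt_at_top[of 0]
    by eventually_elim (auto simp: mag_def field_simps)
qed

definition sigma where "sigma = 1 / sqrt (- g'' m)"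

lemma sigma_pos: "sigma > 0"
  using g''_neg[of m] m_less_1 by (simp add: sigma_def)

lemma sigma_sq: "sigma\<^sup>2 = 1 / (- g'' m)"
  using g''_neg[of m] m_less_1 by (simp add: sigma_def power_divide)

lemma exp_eq_normal_density:
  "exp (g'' m / 2 * u\<^sup>2) = sqrt (2 * pi * sigma\<^sup>2) * normal_density 0 sigma u"
proof -
  have "sqrt (2 * pi * sigma\<^sup>2) > 0" using sigma_pos by simp
  moreover have "- (u - 0)\<^sup>2 / (2 * sigma\<^sup>2) = g'' m / 2 * u\<^sup>2"
    unfolding sigma_sq by simp
  ultimately show ?thesis
    using sigma_pos by (simp add: normal_density_def)
qed

text \<open>The factor sqrt N / 2 is the reciprocal step width. The exponent N (g(t) - g(m)) equals
  r(t) times the square of the rescaled deviation, and the polynomial factor converges because the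
  fractions of plus and minus spins tend to (1 + m) / 2 and (1 - m) / 2.\<close>

lemma weight_limit:
  obtains C where "C > 0"
    "\<And>k u. (\<lambda>N. sqrt (real N) * (mag N (k N) - m)) \<longlonglongrightarrow> u \<Longrightarrow>
       (\<lambda>N. sqrt (real N) / 2 * weight N (k N)) \<longlonglongrightarrow> C * normal_density 0 sigma u"
proof -
  obtain c where c: "c > 0" "(\<lambda>n. stirling_factor n / sqrt (real n)) \<longlonglongrightarrow> c"
    using stirling_factor_asymp .
  obtain r where r: "\<And>t. g t - g m = r t * (t - m)\<^sup>2" "isCont r m" "r m = g'' m / 2"
    using second_order_expansion by blast
  let ?S = "\<lambda>n. stirling_factor n / sqrt (real n)"
  define D where "D = c / (c * c) * (1 / (sqrt (1 + m) * sqrt (1 - m)))"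
  have "D > 0" using c m_pos m_less_1 by (simp add: D_def)
  show ?thesis
  proof (rule that[of "D * sqrt (2 * pi * sigma\<^sup>2)"])
    show "D * sqrt (2 * pi * sigma\<^sup>2) > 0"
      using \<open>D > 0\<close> sigma_pos by simp
    fix k :: "nat \<Rightarrow> nat" and u :: real
    assume lim: "(\<lambda>N. sqrt (real N) * (mag N (k N) - m)) \<longlonglongrightarrow> u"
    note tm = mag_tendsto[OF lim]
    note ev = mag_eventually[OF tm]
    have k_top: "filterlim k at_top sequentially"
    proof (rule filterlim_at_top_mono)
      show "filterlim (\<lambda>N::nat. N div 2) at_top sequentially"
        by (rule filterlim_at_top_div_const_nat) simp
      show "\<forall>\<^sub>F N in sequentially. N div 2 \<le> k N"
        using ev by eventually_elim auto
    qed
    have Nk_top: "filterlim (\<lambda>N. N - k N) at_top sequentially"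
    proof -
      have "filterlim (\<lambda>N. (1 - mag N (k N)) / 2 * real N) at_top sequentially"
        by (rule filterlim_tendsto_pos_mult_at_top[of _ "(1 - m) / 2"])
           (use tm m_less_1 in \<open>auto intro!: tendsto_intros filterlim_real_sequentially\<close>)
      moreover have "\<forall>\<^sub>F N in sequentially. (1 - mag N (k N)) / 2 * real N \<le> real (N - k N)"
        using ev by eventually_elim (auto simp: mag_def field_simps of_nat_diff)
      ultimately have "filterlim (\<lambda>N. real (N - k N)) at_top sequentially"
        by (rule filterlim_at_top_mono)
      then show ?thesis
        by (simp add: filterlim_sequentially_iff_filterlim_real)
    qed
    have "(\<lambda>N. ?S N / (?S (k N) * ?S (N - k N)) *
        (1 / (sqrt (1 + mag N (k N)) * sqrt (1 - mag N (k N)))) *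
        exp (r (mag N (k N)) * (sqrt (real N) * (mag N (k N) - m))\<^sup>2))
        \<longlonglongrightarrow> D * exp (g'' m / 2 * u\<^sup>2)"
      unfolding D_def
    proof (intro tendsto_mult tendsto_divide tendsto_exp tendsto_power lim tendsto_const c(2)
        filterlim_compose[OF c(2) k_top] filterlim_compose[OF c(2) Nk_top])
      show "(\<lambda>N. r (mag N (k N))) \<longlonglongrightarrow> g'' m / 2"
        using isCont_tendsto_compose[OF r(2) tm] r(3) by simp
      show "(\<lambda>N. sqrt (1 + mag N (k N))) \<longlonglongrightarrow> sqrt (1 + m)"
           "(\<lambda>N. sqrt (1 - mag N (k N))) \<longlonglongrightarrow> sqrt (1 - m)"
        by (intro tendsto_intros tm)+
    qed (use c m_pos m_less_1 in auto)
    moreover have "\<forall>\<^sub>F N in sequentially. ?S N / (?S (k N) * ?S (N - k N)) *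
        (1 / (sqrt (1 + mag N (k N)) * sqrt (1 - mag N (k N)))) *
        exp (r (mag N (k N)) * (sqrt (real N) * (mag N (k N) - m))\<^sup>2) =
        sqrt (real N) / 2 * weight N (k N)"
      using ev
    proof eventually_elim
      case (elim N)
      have a: "1 + mag N (k N) = 2 * real (k N) / real N" "1 - mag N (k N) = 2 * real (N - k N) / real N"
        using elim by (auto simp: mag_def field_simps of_nat_diff)
      have pos: "real N > 0" "real (k N) > 0" "real (N - k N) > 0"
        using elim by auto
      have b: "r (mag N (k N)) * (sqrt (real N) * (mag N (k N) - m))\<^sup>2 = real N * (g (mag N (k N)) - g m)"
        unfolding r by (simp add: power_mult_distrib)
      have "?S N / (?S (k N) * ?S (N - k N)) *
          (1 / (sqrt (1 + mag N (k N)) * sqrt (1 - mag N (k N)))) =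
          stirling_factor N / (stirling_factor (k N) * stirling_factor (N - k N)) *
            ((sqrt (real N) * sqrt (real N)) / (sqrt 2 * sqrt 2 * sqrt (real N)))"
      proof -
        \<comment> \<open>Here x, y, z, w stand for the square roots of N, k, N - k and 2.\<close>
        have "A / x / ((B / y) * (D / z)) * (1 / (w * y / x * (w * z / x))) = A / (B * D) * (x * x / (w * w * x))"
          if "x \<noteq> 0" "y \<noteq> 0" "z \<noteq> 0" for A B D x y z w :: real
          using that by (simp add: field_simps)
        then show ?thesis
          unfolding a real_sqrt_mult real_sqrt_divide by this (use pos in auto)
      qed
      also have "\<dots> = sqrt (real N) / 2 * (stirling_factor N / (stirling_factor (k N) * stirling_factor (N - k N)))"
      proof -
        have "A * (x * x / (w * w * x)) = x / 2 * A" if "x \<noteq> 0" "w * w = 2" for A x w :: real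
          using that by simp
        then show ?thesis
          by this (use pos in auto)
      qed
      finally show ?case
        unfolding b using elim by (subst weight_eq) auto
    qed
    ultimately have "(\<lambda>N. sqrt (real N) / 2 * weight N (k N)) \<longlonglongrightarrow> D * exp (g'' m / 2 * u\<^sup>2)"
      by (rule Lim_transform_eventually)
    then show "(\<lambda>N. sqrt (real N) / 2 * weight N (k N))
        \<longlonglongrightarrow> D * sqrt (2 * pi * sigma\<^sup>2) * normal_density 0 sigma u"
      unfolding exp_eq_normal_density by (simp only: mult.assoc)
  qed
qed

text \<open>Up to t = m + d both spin counts are at least a fixed multiple of \<open>N\<close>, and
  the polynomial factor is bounded. Beyond it only \<open>stirling_factor_ge_1\<close> is available
  for the minus spins, which costs a factor of order \<open>N\<close>. There the rescaled deviation
  is at least d sqrt N, so half of the exponential decay absorbs this factor; hence c = c0 /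
  2.\<close>

lemma weight_bound:
  obtains C c where "C > 0" "c > 0"
    "\<And>N k. N > 0 \<Longrightarrow> k \<le> N \<Longrightarrow> N < 2 * k \<Longrightarrow>
       sqrt (real N) / 2 * weight N k \<le> C * exp (- c * (sqrt (real N) * (mag N k - m))\<^sup>2)"
proof -
  obtain a b where ab: "a > 0" "b > 0" "\<And>n. a * sqrt (real n) \<le> stirling_factor n"
    "\<And>n. n > 0 \<Longrightarrow> stirling_factor n \<le> b * sqrt (real n)"
    using stirling_factor_bounds by blast
  obtain c0 where c0: "c0 > 0" "\<And>t. t \<in> {0..1} \<Longrightarrow> g t - g m \<le> - c0 * (t - m)\<^sup>2"
    using quadratic_upper_bound by blast
  define c where "c = c0 / 2"
  \<comment> \<open>Half the distance from \<open>m\<close> to 1, so that t \<le> m + d leaves 1 - t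
    \<ge> d.\<close>
  define d where "d = (1 - m) / 2"
  have d: "d > 0" and c: "c > 0" using m_less_1 c0 by (auto simp: d_def c_def)
  define C1 where "C1 = b / (a\<^sup>2 * sqrt (1 / 2) * sqrt (d / 2)) / 2"
  define C2 where "C2 = b / (2 * c * d\<^sup>2)"
  have C: "C1 > 0" "C2 > 0" using ab d c by (auto simp: C1_def C2_def)
  show ?thesis
  proof (rule that[of "C1 + C2" c])
    fix N k :: nat
    assume Nk: "N > 0" "k \<le> N" "N < 2 * k"
    define t where "t = mag N k"
    define s where "s = sqrt (real N) * (t - m)"
    have t: "0 \<le> t" "t \<le> 1"
      using Nk by (auto simp: t_def mag_def field_simps)
    have "real N * (g t - g m) \<le> real N * (- c0 * (t - m)\<^sup>2)"
      using c0(2)[of t] t by (intro mult_left_mono) auto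
    also have "\<dots> = - (2 * c) * s\<^sup>2"
      by (simp add: s_def c_def power_mult_distrib)
    finally have e: "exp (real N * (g t - g m)) \<le> exp (- (2 * c) * s\<^sup>2)"
      by simp
    have S1: "stirling_factor n \<ge> 1" "stirling_factor n > 0" for n
      using stirling_factor_ge_1[of n] by auto
    have "sqrt (real N) / 2 * weight N k \<le> (C1 + C2) * exp (- c * s\<^sup>2)"
    proof (cases "t \<le> m + d")
      case True
      have "a * sqrt (real N * (1 / 2)) \<le> a * sqrt (real k)"
        using Nk ab by (intro mult_left_mono real_sqrt_le_mono) auto
      also have "\<dots> \<le> stirling_factor k" by (rule ab)
      finally have 1: "a * sqrt (real N * (1 / 2)) \<le> stirling_factor k" .
      have "real (N - k) = real N * ((1 - t) / 2)"
        using Nk by (simp add: t_def mag_def of_nat_diff field_simps)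
      moreover have "d \<le> 1 - t" using True by (simp add: d_def field_simps)
      ultimately have "a * sqrt (real N * (d / 2)) \<le> a * sqrt (real (N - k))"
        using ab by (intro mult_left_mono real_sqrt_le_mono) (auto intro!: mult_left_mono)
      also have "\<dots> \<le> stirling_factor (N - k)" by (rule ab)
      finally have 2: "a * sqrt (real N * (d / 2)) \<le> stirling_factor (N - k)" .
      have "sqrt (real N) / 2 * (stirling_factor N / (stirling_factor k * stirling_factor (N - k)))
          \<le> sqrt (real N) / 2 * ((b * sqrt (real N)) /
              ((a * sqrt (real N * (1 / 2))) * (a * sqrt (real N * (d / 2)))))"
        using Nk ab d S1 1 2
        by (intro mult_left_mono frac_le mult_mono) (auto intro!: mult_pos_pos intro: less_imp_le)
      also have "\<dots> = C1"
      proof -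
        have "x / 2 * (b * x / (a * (x * y) * (a * (x * z)))) = b / (a\<^sup>2 * y * z) / 2"
          if "x \<noteq> 0" for x y z :: real
          using that by (simp add: power2_eq_square mult_ac)
        then show ?thesis
          unfolding C1_def real_sqrt_mult[of "real N"] by this (use Nk in auto)
      qed
      finally have 3: "sqrt (real N) / 2 * (stirling_factor N / (stirling_factor k * stirling_factor (N - k))) \<le> C1" .
      have "exp (- (2 * c) * s\<^sup>2) \<le> exp (- c * s\<^sup>2)"
        using c by (simp add: mult_right_mono)
      with e have e': "exp (real N * (g t - g m)) \<le> exp (- c * s\<^sup>2)"
        by linarith
      have "sqrt (real N) / 2 * weight N k \<le> C1 * exp (- c * s\<^sup>2)"
        using mult_mono[OF 3 e'] C Nk by (simp add: weight_eq t_def mult_ac)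
      also have "\<dots> \<le> (C1 + C2) * exp (- c * s\<^sup>2)"
        using C by (intro mult_right_mono) auto
      finally show ?thesis .
    next
      case False
      have "sqrt (real N) / 2 * (stirling_factor N / (stirling_factor k * stirling_factor (N - k)))
          \<le> sqrt (real N) / 2 * (b * sqrt (real N) / (1 * 1))"
        using Nk ab S1
        by (intro mult_left_mono frac_le mult_mono) (auto intro!: mult_pos_pos intro: less_imp_le)
      also have "\<dots> = b / 2 * real N" by simp
      finally have 3: "sqrt (real N) / 2 * (stirling_factor N / (stirling_factor k * stirling_factor (N - k))) \<le> b / 2 * real N" .
      have 4: "real N * exp (- c * s\<^sup>2) \<le> 1 / (c * d\<^sup>2)"
      proof -
        have "d\<^sup>2 \<le> (t - m)\<^sup>2" using False d by (intro power_mono) auto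
        then have "c * (real N * d\<^sup>2) \<le> c * s\<^sup>2"
          using c by (simp add: s_def power_mult_distrib mult_left_mono)
        also have "\<dots> \<le> exp (c * s\<^sup>2)"
          using exp_ge_add_one_self[of "c * s\<^sup>2"] by linarith
        finally have "real N * (c * d\<^sup>2) \<le> exp (c * s\<^sup>2)"
          by (simp add: mult_ac)
        then show ?thesis
          using c d by (simp add: exp_minus field_simps)
      qed
      have "sqrt (real N) / 2 * weight N k \<le> (b / 2 * real N) * exp (- (2 * c) * s\<^sup>2)"
        using mult_mono[OF 3 e] ab Nk by (simp add: weight_eq t_def mult_ac)
      also have "\<dots> = b / 2 * (real N * exp (- c * s\<^sup>2)) * exp (- c * s\<^sup>2)"
        by (simp flip: exp_add)
      also have "\<dots> \<le> b / 2 * (1 / (c * d\<^sup>2)) * exp (- c * s\<^sup>2)"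
        using 4 ab by (intro mult_right_mono mult_left_mono) auto
      also have "\<dots> = C2 * exp (- c * s\<^sup>2)"
        by (simp add: C2_def)
      also have "\<dots> \<le> (C1 + C2) * exp (- c * s\<^sup>2)"
        using C by (intro mult_right_mono) auto
      finally show ?thesis .
    qed
    then show "sqrt (real N) / 2 * weight N k \<le> (C1 + C2) * exp (- c * (sqrt (real N) * (mag N k - m))\<^sup>2)"
      by (simp add: s_def t_def)
  qed (use C c in auto)
qed

text \<open>Solving sqrt N (mag N k - m) = u for \<open>k\<close> and rounding down gives the step
  that contains \<open>u\<close>. The second assumption keeps \<open>nat\<close> from
  truncating.\<close>

lemma mag_floor_bounds:
  fixes u :: real
  assumes "N > 0" "real N * (1 + m) + sqrt (real N) * u \<ge> 0"
  defines "k \<equiv> nat \<lfloor>(real N * (1 + m) + sqrt (real N) * u) / 2\<rfloor>"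
  shows "sqrt (real N) * (mag N k - m) \<le> u" "u < sqrt (real N) * (mag N k - m) + 2 / sqrt (real N)"
proof -
  define n where "n = sqrt (real N)"
  have n: "n > 0" "real N = n * n" using assms by (auto simp: n_def)
  define z where "z = (real N * (1 + m) + n * u) / 2"
  have "real k = of_int \<lfloor>z\<rfloor>"
    using assms(2) by (simp add: k_def z_def n_def)
  then have "real k \<le> z" "z < real k + 1"
    by linarith+
  then have "2 * real k \<le> n * (n * (1 + m) + u)" "n * (n * (1 + m) + u) < 2 * real k + 2"
    by (auto simp: z_def n algebra_simps)
  moreover have "2 * real k = n * (n * (1 + m) + n * (mag N k - m))"
    using n by (simp add: mag_def algebra_simps)
  ultimately have "n * (n * (mag N k - m)) \<le> n * u" "n * u < n * (n * (mag N k - m) + 2 / n)"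
    using n by (simp_all add: algebra_simps)
  then show "sqrt (real N) * (mag N k - m) \<le> u" "u < sqrt (real N) * (mag N k - m) + 2 / sqrt (real N)"
    using n(1) unfolding n_def[symmetric] by simp_all
qed

lemma mag_floor_tendsto:
  fixes u :: real
  defines "k \<equiv> \<lambda>N. nat \<lfloor>(real N * (1 + m) + sqrt (real N) * u) / 2\<rfloor>"
  shows "\<forall>\<^sub>F N in sequentially. sqrt (real N) * (mag N (k N) - m) \<le> u \<and>
           u < sqrt (real N) * (mag N (k N) - m) + 2 / sqrt (real N)"
    and "(\<lambda>N. sqrt (real N) * (mag N (k N) - m)) \<longlonglongrightarrow> u"
proof -
  have "filterlim (\<lambda>N. real N * (1 + m) + sqrt (real N) * u) at_top sequentially"
    using m_pos by real_asymp
  then have "\<forall>\<^sub>F N in sequentially. real N * (1 + m) + sqrt (real N) * u \<ge> 0"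
    unfolding filterlim_at_top by blast
  then show ev: "\<forall>\<^sub>F N in sequentially. sqrt (real N) * (mag N (k N) - m) \<le> u \<and>
           u < sqrt (real N) * (mag N (k N) - m) + 2 / sqrt (real N)"
    using eventually_gt_at_top[of 0]
    by eventually_elim (use mag_floor_bounds in \<open>auto simp: k_def\<close>)
  show "(\<lambda>N. sqrt (real N) * (mag N (k N) - m)) \<longlonglongrightarrow> u"
  proof (rule tendsto_sandwich)
    show "\<forall>\<^sub>F N in sequentially. u - 2 / sqrt (real N) \<le> sqrt (real N) * (mag N (k N) - m)"
      using ev by eventually_elim auto
    show "\<forall>\<^sub>F N in sequentially. sqrt (real N) * (mag N (k N) - m) \<le> u"
      using ev by eventually_elim auto
    show "(\<lambda>N. u - 2 / sqrt (real N)) \<longlonglongrightarrow> u" by real_asymp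
  qed auto
qed

text \<open>The sum over \<open>k\<close> is the integral of a step function in \<open>u = sqrt N * (mag N k - m)\<close>,
  to which dominated convergence applies.\<close>
lemma positive_weight_sum_limit:
  obtains C where "C > 0"
    "\<And>Q L y. (\<And>k u. u \<noteq> y \<Longrightarrow> (\<lambda>N. sqrt (real N) * (mag N (k N) - m)) \<longlonglongrightarrow> u \<Longrightarrow>
          \<forall>\<^sub>F N in sequentially. Q N (mag N (k N)) \<longleftrightarrow> u \<in> L) \<Longrightarrow> L \<in> sets borel \<Longrightarrow>
       (\<lambda>N. \<Sum>k | k \<le> N \<and> N < 2 * k. weight N k * of_bool (Q N (mag N k))) \<longlonglongrightarrow>
         C * (\<integral>u. normal_density 0 sigma u * indicator L u \<partial>lborel)"
proof -
  obtain C where C: "C > 0" "\<And>k u. (\<lambda>N. sqrt (real N) * (mag N (k N) - m)) \<longlonglongrightarrow> u \<Longrightarrow>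
       (\<lambda>N. sqrt (real N) / 2 * weight N (k N)) \<longlonglongrightarrow> C * normal_density 0 sigma u"
    using weight_limit by blast
  obtain B c where B: "B > 0" "c > 0" "\<And>N k. N > 0 \<Longrightarrow> k \<le> N \<Longrightarrow> N < 2 * k \<Longrightarrow>
       sqrt (real N) / 2 * weight N k \<le> B * exp (- c * (sqrt (real N) * (mag N k - m))\<^sup>2)"
    using weight_bound by blast
  show ?thesis
  proof (rule that[OF C(1)])
    \<comment> \<open>The constant is fixed before \<open>Q\<close>, so all events share it. At
      \<open>y\<close>, the boundary of the limiting event, convergence may fail; a single point is
      a null set.\<close>
    fix Q :: "nat \<Rightarrow> real \<Rightarrow> bool" and L :: "real set" and y :: real
    assume Q: "\<And>k u. u \<noteq> y \<Longrightarrow> (\<lambda>N. sqrt (real N) * (mag N (k N) - m)) \<longlonglongrightarrow> u \<Longrightarrow>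
          \<forall>\<^sub>F N in sequentially. Q N (mag N (k N)) \<longleftrightarrow> u \<in> L"
      and L [measurable]: "L \<in> sets borel"
    define A where "A N = {k. k \<le> N \<and> N < 2 * k}" for N :: nat
    define x where "x N k = sqrt (real N) * (mag N k - m)" for N k
    define J where "J N k = {x N k..<x N k + 2 / sqrt (real N)}" for N k
    define a where "a N k = sqrt (real N) / 2 * weight N k * of_bool (Q N (mag N k))" for N k
    define F where "F N u = (\<Sum>k\<in>A N. a N k * indicator (J N k) u)" for N u
    have fin: "finite (A N)" for N by (simp add: A_def)
    \<comment> \<open>The half-open steps have left endpoints at least one width apart, so they are
      disjoint and at most one summand is nonzero.\<close>
    have F_val: "F N u = (if k \<in> A N then a N k else 0)" if "u \<in> J N k" "N > 0" for N u k
    proof -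
      have "u \<notin> J N j" if "j \<noteq> k" for j
      proof
        assume j: "u \<in> J N j"
        define n where "n = sqrt (real N)"
        have n: "n > 0" "real N = n * n" using \<open>N > 0\<close> by (auto simp: n_def)
        have x: "n * x N i = 2 * real i - n * n * (1 + m)" for i
          using n by (simp add: x_def mag_def flip: n_def) (simp add: algebra_simps)
        have lt: "i' < i + 1" if "x N i' < x N i + 2 / n" for i i'
        proof -
          have "n * x N i' < n * (x N i + 2 / n)"
            using that n by simp
          also have "\<dots> = n * x N i + 2"
            using n by (simp add: distrib_left)
          finally have "real i' < real i + 1"
            unfolding x by simp
          then show ?thesis by linarith
        qed
        have "x N j < x N k + 2 / n" "x N k < x N j + 2 / n"
          using j \<open>u \<in> J N k\<close> by (auto simp: J_def n_def)
        then show False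
          using lt[of j k] lt[of k j] \<open>j \<noteq> k\<close> by linarith
      qed
      then have "F N u = (\<Sum>j\<in>A N. if j = k then a N k else 0)"
        unfolding F_def using that by (intro sum.cong) (auto simp: indicator_def)
      then show ?thesis using fin by simp
    qed
    have F_out: "F N u = 0" if "\<And>k. k \<in> A N \<Longrightarrow> u \<notin> J N k" for N u
      unfolding F_def using that by (intro sum.neutral) auto
    have int: "(\<integral>u. F N u \<partial>lborel) = (\<Sum>k\<in>A N. weight N k * of_bool (Q N (mag N k)))" if "N > 0" for N
    proof -
      have "(\<integral>u. F N u \<partial>lborel) = 2 / sqrt (real N) * (\<Sum>k\<in>A N. a N k)"
        unfolding F_def J_def by (intro integral_step_function fin) auto
      also have "\<dots> = (\<Sum>k\<in>A N. weight N k * of_bool (Q N (mag N k)))"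
        unfolding sum_distrib_left a_def using that by (intro sum.cong) auto
      finally show ?thesis .
    qed
    have meas [measurable]: "F N \<in> borel_measurable lborel" for N
      unfolding F_def[abs_def] J_def by measurable
    \<comment> \<open>The weight is bounded in terms of the left endpoint x of the step, at distance
      at most 2 from \<open>u\<close>. From u^2 \<le> 8 + 2 x^2 come the halved rate and the factor
      exp(4c).\<close>
    let ?w = "\<lambda>u. B * exp (4 * c) * exp (- (c / 2) * u\<^sup>2)"
    have bound: "norm (F N u) \<le> ?w u" if "N > 0" for N u
    proof (cases "\<exists>k\<in>A N. u \<in> J N k")
      case False
      then show ?thesis using F_out[of N u] B by auto
    next
      case True
      then obtain k where k: "k \<in> A N" "u \<in> J N k" by auto
      have "norm (F N u) = a N k"
      proof -
        have "a N k \<ge> 0" using weight_nonneg by (simp add: a_def)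
        then show ?thesis using F_val[OF k(2) that] k(1) by simp
      qed
      also have "\<dots> \<le> sqrt (real N) / 2 * weight N k"
        using weight_nonneg by (auto simp: a_def)
      also have "\<dots> \<le> B * exp (- c * (x N k)\<^sup>2)"
        unfolding x_def using k that by (intro B) (auto simp: A_def)
      also have "\<dots> \<le> B * exp (4 * c - (c / 2) * u\<^sup>2)"
      proof -
        have "2 / sqrt (real N) \<le> 2"
          using that by (simp add: field_simps)
        then have "(u - x N k)\<^sup>2 \<le> 2\<^sup>2"
          using k by (intro power_mono) (auto simp: J_def)
        moreover have "u\<^sup>2 \<le> 2 * (u - x N k)\<^sup>2 + 2 * (x N k)\<^sup>2"
          using zero_le_power2[of "u - 2 * x N k"] by (simp add: power2_eq_square algebra_simps)
        ultimately have "u\<^sup>2 \<le> 8 + 2 * (x N k)\<^sup>2"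
          by simp
        then have "c / 2 * u\<^sup>2 \<le> c / 2 * (8 + 2 * (x N k)\<^sup>2)"
          using B by (intro mult_left_mono) auto
        then have "- c * (x N k)\<^sup>2 \<le> 4 * c - (c / 2) * u\<^sup>2"
          by (simp add: algebra_simps)
        then show ?thesis
          using B by (intro mult_left_mono) auto
      qed
      also have "\<dots> = ?w u"
        by (simp add: mult.assoc flip: exp_add)
      finally show ?thesis .
    qed
    have lim: "(\<lambda>N. F N u) \<longlonglongrightarrow> C * (normal_density 0 sigma u * indicator L u)" if "u \<noteq> y" for u
    proof -
      define k where "k N = nat \<lfloor>(real N * (1 + m) + sqrt (real N) * u) / 2\<rfloor>" for N :: nat
      note kt = mag_floor_tendsto[of u, folded k_def]
      have "(\<lambda>N. sqrt (real N) / 2 * weight N (k N) * indicator L u)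
          \<longlonglongrightarrow> C * normal_density 0 sigma u * indicator L u"
        by (intro tendsto_mult C kt tendsto_const)
      moreover have "\<forall>\<^sub>F N in sequentially. sqrt (real N) / 2 * weight N (k N) * indicator L u = F N u"
        using mag_eventually[OF mag_tendsto[OF kt(2)]] kt(1) Q[OF that kt(2)]
      proof eventually_elim
        case (elim N)
        have "u \<in> J N (k N)" "k N \<in> A N"
          using elim by (auto simp: J_def x_def A_def)
        then have "F N u = a N (k N)"
          using F_val elim by simp
        then show ?case
          using elim by (auto simp: a_def indicator_def)
      qed
      ultimately show ?thesis
        unfolding mult.assoc[of C] by (rule Lim_transform_eventually)
    qed
    \<comment> \<open>The shift to \<open>Suc N\<close> secures the positivity on which the bound
      and the value of the integral rely.\<close>
    have "(\<lambda>N. \<integral>u. F (Suc N) u \<partial>lborel) \<longlonglongrightarrow> (\<integral>u. C * (normal_density 0 sigma u * indicator L u) \<partial>lborel)"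
    proof (rule integral_dominated_convergence[where w = ?w])
      show "integrable lborel ?w"
        using integrable_gaussian[of "c / 2"] B by simp
      show "AE u in lborel. norm (F (Suc N) u) \<le> ?w u" for N
        by (intro AE_I2 bound) simp
      have "AE u in lborel. u \<noteq> y"
        by (rule AE_lborel_singleton)
      then show "AE u in lborel. (\<lambda>N. F (Suc N) u) \<longlonglongrightarrow> C * (normal_density 0 sigma u * indicator L u)"
        by eventually_elim (intro LIMSEQ_Suc lim)
    qed measurable
    then have "(\<lambda>N. \<Sum>k\<in>A (Suc N). weight (Suc N) k * of_bool (Q (Suc N) (mag (Suc N) k))) \<longlonglongrightarrow>
        C * (\<integral>u. normal_density 0 sigma u * indicator L u \<partial>lborel)"
      unfolding int[OF zero_less_Suc] by simp
    then show "(\<lambda>N. \<Sum>k | k \<le> N \<and> N < 2 * k. weight N k * of_bool (Q N (mag N k))) \<longlonglongrightarrow>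
         C * (\<integral>u. normal_density 0 sigma u * indicator L u \<partial>lborel)"
      unfolding A_def by (rule LIMSEQ_imp_Suc)
  qed
qed

section \<open>The estimator event on the scale of the fluctuations\<close>

definition mpl_event :: "real \<Rightarrow> nat \<Rightarrow> real \<Rightarrow> bool" where
  "mpl_event x N t \<longleftrightarrow>
     mean_mpl p t < \<infinity> \<and> sqrt (real N) * (real_of_ereal (mean_mpl p t) - \<beta>) \<le> x"

definition slope where "slope = - g'' m / (real p * m ^ (p - 1))"

lemma slope_pos: "slope > 0"
  unfolding slope_def using g''_neg[of m] m_less_1 m_pos p_ge_2
  by (intro divide_pos_pos mult_pos_pos) auto

text \<open>The delta method: the estimation error is - g'(t) / (p t^(p-1)), and Caratheodory's form
  of the derivative of \<open>g'\<close> at its zero \<open>m\<close> shows that the rescaled error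
  tends to slope * u. A strict inequality in the limit decides the event eventually; equality would
  not.\<close>

lemma mpl_event_limit:
  assumes u: "u \<noteq> x / slope" and lim: "(\<lambda>N. sqrt (real N) * (mag N (k N) - m)) \<longlonglongrightarrow> u"
  shows "\<forall>\<^sub>F N in sequentially. mpl_event x N (mag N (k N)) \<longleftrightarrow> u \<in> {..x / slope}"
proof -
  note tm = mag_tendsto[OF lim]
  note ev = mag_eventually[OF tm]
  obtain q where q: "\<And>t. g' t - g' m = q t * (t - m)" "isCont q m" "q m = g'' m"
    using g'_deriv[of m] m_pos m_less_1 by (auto simp: CARAT_DERIV)
  have eta: "artanh t / (real p * t ^ (p - 1)) - \<beta> = - q t * (t - m) / (real p * t ^ (p - 1))"
    if "t > 0" for t
  proof -
    have "q t * (t - m) = g' t"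
      using q(1)[of t] g'_m by simp
    then show ?thesis
      using that p_ge_2 by (simp add: g'_def field_simps)
  qed
  have "(\<lambda>N. - q (mag N (k N)) * (sqrt (real N) * (mag N (k N) - m)) / (real p * mag N (k N) ^ (p - 1)))
      \<longlonglongrightarrow> - g'' m * u / (real p * m ^ (p - 1))"
    using m_pos p_ge_2 isCont_tendsto_compose[OF q(2) tm] q(3)
    by (intro tendsto_intros lim tm) auto
  then have conv: "(\<lambda>N. - q (mag N (k N)) * (sqrt (real N) * (mag N (k N) - m)) / (real p * mag N (k N) ^ (p - 1)))
      \<longlonglongrightarrow> slope * u"
    by (simp add: slope_def)
  have eq: "\<forall>\<^sub>F N in sequentially. mpl_event x N (mag N (k N)) \<longleftrightarrow>
      - q (mag N (k N)) * (sqrt (real N) * (mag N (k N) - m)) / (real p * mag N (k N) ^ (p - 1)) \<le> x"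
    using ev
  proof eventually_elim
    case (elim N)
    have "sqrt (real N) * (artanh (mag N (k N)) / (real p * mag N (k N) ^ (p - 1)) - \<beta>) =
      - q (mag N (k N)) * (sqrt (real N) * (mag N (k N) - m)) / (real p * mag N (k N) ^ (p - 1))"
      using elim by (subst eta) auto
    then show ?case
      using elim p_ge_2 by (simp add: mpl_event_def mean_mpl_pos)
  qed
  show ?thesis
  proof (cases "u < x / slope")
    case True
    then have "slope * u < x"
      using slope_pos by (simp add: field_simps)
    from eq order_tendstoD(2)[OF conv this] show ?thesis
      by eventually_elim (use True in auto)
  next
    case False
    then have "slope * u > x" "\<not> u \<le> x / slope"
      using slope_pos u by (auto simp: field_simps)
    from eq order_tendstoD(1)[OF conv this(1)] show ?thesis
      by eventually_elim (use \<open>\<not> u \<le> x / slope\<close> in auto)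
  qed
qed

section \<open>Contribution of nonpositive magnetizations\<close>

lemma weight_le_if_nonpos:
  assumes "N > 0" "mag N k ^ p \<le> 0"
  shows "weight N k \<le> real (N choose k) / 2 ^ N * exp (- real N * g m)"
proof -
  have "exp (real N * \<beta> * mag N k ^ p) \<le> 1"
    using assms beta_pos by (simp add: mult_nonneg_nonpos)
  then have "real (N choose k) * exp (real N * \<beta> * mag N k ^ p) / (2 ^ N * exp (real N * g m))
      \<le> real (N choose k) * 1 / (2 ^ N * exp (real N * g m))"
    by (intro divide_right_mono mult_left_mono) auto
  then show ?thesis
    by (simp add: weight_def exp_minus field_simps)
qed

text \<open>Where t^p \<le> 0 the Gibbs factor is at most 1, and the binomial coefficients add up to
  at most 2^N. The result is exponentially small because g(m) > 0.\<close>

lemma sum_weight_nonpos_le: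
  assumes "N > 0" "A \<subseteq> {..N}" "\<And>k. k \<in> A \<Longrightarrow> mag N k ^ p \<le> 0"
  shows "(\<Sum>k\<in>A. weight N k * of_bool (P k)) \<le> exp (- real N * g m)"
proof -
  have "(\<Sum>k\<in>A. weight N k * of_bool (P k)) \<le> (\<Sum>k\<in>A. real (N choose k) / 2 ^ N * exp (- real N * g m))"
  proof (rule sum_mono)
    fix k assume "k \<in> A"
    have "weight N k * of_bool (P k) \<le> weight N k"
      using weight_nonneg by simp
    also have "\<dots> \<le> real (N choose k) / 2 ^ N * exp (- real N * g m)"
      using assms \<open>k \<in> A\<close> by (intro weight_le_if_nonpos) auto
    finally show "weight N k * of_bool (P k) \<le> real (N choose k) / 2 ^ N * exp (- real N * g m)" .
  qed
  also have "\<dots> \<le> (\<Sum>k\<le>N. real (N choose k) / 2 ^ N * exp (- real N * g m))"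
    using assms by (intro sum_mono2) auto
  also have "\<dots> = real (\<Sum>k\<le>N. N choose k) / 2 ^ N * exp (- real N * g m)"
    by (simp add: sum_distrib_right sum_divide_distrib)
  also have "\<dots> = exp (- real N * g m)"
    by (subst choose_row_sum) simp
  finally show ?thesis .
qed

text \<open>For even \<open>p\<close>, exchanging plus and minus spins maps the negative half onto
  the positive half, and only t = 0 is left over. For odd \<open>p\<close>, all t \<le> 0 are left
  over.\<close>

lemma weight_sum_remainder:
  assumes N: "N > 0" and sym: "even p \<Longrightarrow> \<forall>t. Q (- t) = Q t"
  shows "\<bar>(\<Sum>k\<le>N. weight N k * of_bool (Q (mag N k))) -
      (if even p then 2 else 1) * (\<Sum>k | k \<le> N \<and> N < 2 * k. weight N k * of_bool (Q (mag N k)))\<bar>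
    \<le> exp (- real N * g m)"
proof -
  let ?f = "\<lambda>k. weight N k * of_bool (Q (mag N k))"
  have nonneg: "(\<Sum>k\<in>A. ?f k) \<ge> 0" for A
    using weight_nonneg by (intro sum_nonneg) auto
  show ?thesis
  proof (cases "even p")
    case True
    have split: "{..N} = {k. k \<le> N \<and> N < 2 * k} \<union> {k. k \<le> N \<and> 2 * k < N} \<union> {k. k \<le> N \<and> 2 * k = N}"
      by auto
    have "(\<Sum>k\<le>N. ?f k) = (\<Sum>k | k \<le> N \<and> N < 2 * k. ?f k) + (\<Sum>k | k \<le> N \<and> 2 * k < N. ?f k)
        + (\<Sum>k | k \<le> N \<and> 2 * k = N. ?f k)"
      unfolding split by (subst sum.union_disjoint; (subst sum.union_disjoint)?) auto
    also have "(\<Sum>k | k \<le> N \<and> 2 * k < N. ?f k) = (\<Sum>k | k \<le> N \<and> N < 2 * k. ?f k)"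
    proof (rule sum.reindex_bij_witness[where i = "\<lambda>k. N - k" and j = "\<lambda>k. N - k"])
      fix k assume k: "k \<in> {k. k \<le> N \<and> 2 * k < N}"
      have "mag N (N - k) = - mag N k"
        using k N by (auto simp: mag_def of_nat_diff field_simps)
      then show "?f (N - k) = ?f k"
        using True sym k by (simp add: weight_def binomial_symmetric[of k N])
    qed auto
    finally have "(\<Sum>k\<le>N. ?f k) - 2 * (\<Sum>k | k \<le> N \<and> N < 2 * k. ?f k) = (\<Sum>k | k \<le> N \<and> 2 * k = N. ?f k)"
      by simp
    moreover have "(\<Sum>k | k \<le> N \<and> 2 * k = N. ?f k) \<le> exp (- real N * g m)"
      using N p_ge_2 by (intro sum_weight_nonpos_le) (auto simp: mag_def power_0_left)
    ultimately show ?thesis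
      using nonneg[of "{k. k \<le> N \<and> 2 * k = N}"] unfolding if_P[OF True] by linarith
  next
    case False
    have split: "{..N} = {k. k \<le> N \<and> N < 2 * k} \<union> {k. k \<le> N \<and> 2 * k \<le> N}"
      by auto
    have "(\<Sum>k\<le>N. ?f k) = (\<Sum>k | k \<le> N \<and> N < 2 * k. ?f k) + (\<Sum>k | k \<le> N \<and> 2 * k \<le> N. ?f k)"
      unfolding split by (subst sum.union_disjoint) auto
    then have "(\<Sum>k\<le>N. ?f k) - (\<Sum>k | k \<le> N \<and> N < 2 * k. ?f k) = (\<Sum>k | k \<le> N \<and> 2 * k \<le> N. ?f k)"
      by simp
    moreover have "(\<Sum>k | k \<le> N \<and> 2 * k \<le> N. ?f k) \<le> exp (- real N * g m)"
      using N p_ge_2 False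
      by (intro sum_weight_nonpos_le) (auto simp: mag_def power_le_zero_eq field_simps)
    ultimately show ?thesis
      using nonneg[of "{k. k \<le> N \<and> 2 * k \<le> N}"] unfolding if_not_P[OF False] by linarith
  qed
qed

lemma weight_sum_tendsto:
  assumes lim: "(\<lambda>N. \<Sum>k | k \<le> N \<and> N < 2 * k. weight N k * of_bool (Q N (mag N k))) \<longlonglongrightarrow> l"
    and sym: "even p \<Longrightarrow> \<forall>N t. Q N (- t) = Q N t"
  shows "(\<lambda>N. \<Sum>k\<le>N. weight N k * of_bool (Q N (mag N k))) \<longlonglongrightarrow> (if even p then 2 else 1) * l"
proof -
  let ?e = "if even p then 2 else 1 :: real"
  let ?T = "\<lambda>N. \<Sum>k\<le>N. weight N k * of_bool (Q N (mag N k))"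
  let ?M = "\<lambda>N. \<Sum>k | k \<le> N \<and> N < 2 * k. weight N k * of_bool (Q N (mag N k))"
  have "(\<lambda>N. ?T N - ?e * ?M N) \<longlonglongrightarrow> 0"
  proof (rule Lim_null_comparison)
    show "\<forall>\<^sub>F N in sequentially. norm (?T N - ?e * ?M N) \<le> exp (- real N * g m)"
      using eventually_gt_at_top[of 0]
    proof eventually_elim
      case (elim N)
      show ?case
        using weight_sum_remainder[OF elim, of "Q N"] sym by simp
    qed
    show "(\<lambda>N. exp (- real N * g m)) \<longlonglongrightarrow> 0"
      using g_m_pos by real_asymp
  qed
  then have "(\<lambda>N. (?T N - ?e * ?M N) + ?e * ?M N) \<longlonglongrightarrow> 0 + ?e * l"
    by (intro tendsto_add tendsto_mult tendsto_const lim)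
  then show ?thesis by simp
qed

text \<open>The partition function is written with \<open>of_bool True\<close> to make it an
  instance of the same limit statement as the numerator.\<close>

lemma cw_prob_eq:
  assumes "N > 0"
  shows "cw_prob p N \<beta> {X. mpl_est p N X < \<infinity> \<and> sqrt (real N) * (real_of_ereal (mpl_est p N X) - \<beta>) \<le> x} =
    (\<Sum>k\<le>N. weight N k * of_bool (mpl_event x N (mag N k))) / (\<Sum>k\<le>N. weight N k * of_bool True)"
proof -
  have p: "p > 0" using p_ge_2 by simp
  let ?E = "{X. mpl_est p N X < \<infinity> \<and> sqrt (real N) * (real_of_ereal (mpl_est p N X) - \<beta>) \<le> x}"
  define A where "A = 2 ^ N * exp (real N * g m)"
  have A: "A \<noteq> 0" by (simp add: A_def)
  define f where "f P s = exp (real N * \<beta> * (s / real N) ^ p) * of_bool (P (s / real N))" for P :: "real \<Rightarrow> bool" and s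
  have sum_f: "(\<Sum>X\<in>cw_configs N. f P (\<Sum>i<N. X i)) = A * (\<Sum>k\<le>N. weight N k * of_bool (P (mag N k)))" for P
  proof -
    have "(2 * real k - real N) / real N = mag N k" for k
      using assms by (simp add: mag_def field_simps)
    then show ?thesis
      unfolding sum_cw_configs sum_distrib_left
      by (intro sum.cong) (simp_all add: f_def weight_def A_def)
  qed
  have "(\<Sum>X\<in>cw_configs N \<inter> ?E. exp (\<beta> * cw_H p N X)) =
      (\<Sum>X\<in>cw_configs N. if X \<in> ?E then exp (\<beta> * cw_H p N X) else 0)"
    by (rule sum.inter_restrict[OF finite_cw_configs])
  also have "\<dots> = (\<Sum>X\<in>cw_configs N. f (mpl_event x N) (\<Sum>i<N. X i))"
    unfolding mpl_est_eq[OF assms p] cw_H_eq[OF assms p]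
    by (intro sum.cong refl) (simp add: f_def mpl_event_def cw_mean_def mult_ac)
  finally have num: "(\<Sum>X\<in>cw_configs N \<inter> ?E. exp (\<beta> * cw_H p N X)) =
      A * (\<Sum>k\<le>N. weight N k * of_bool (mpl_event x N (mag N k)))"
    unfolding sum_f .
  have "(\<Sum>X\<in>cw_configs N. exp (\<beta> * cw_H p N X)) = (\<Sum>X\<in>cw_configs N. f (\<lambda>_. True) (\<Sum>i<N. X i))"
    unfolding cw_H_eq[OF assms p] by (intro sum.cong refl) (simp add: f_def cw_mean_def mult_ac)
  then have den: "(\<Sum>X\<in>cw_configs N. exp (\<beta> * cw_H p N X)) = A * (\<Sum>k\<le>N. weight N k * of_bool True)"
    unfolding sum_f .
  show ?thesis
    unfolding cw_prob_def num den using A by simp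
qed

end

section \<open>Passage to the normal distribution function and conclusion\<close>

lemma normal_cdf_eq: "normal_cdf v x = (\<integral>u. normal_density 0 (sqrt v) u * indicator {..x} u \<partial>lborel)"
proof -
  have "emeasure (density lborel (normal_density 0 (sqrt v))) {..x} =
      (\<integral>\<^sup>+u. ennreal (normal_density 0 (sqrt v) u) * indicator {..x} u \<partial>lborel)"
    by (subst emeasure_density) auto
  also have "\<dots> = (\<integral>\<^sup>+u. ennreal (normal_density 0 (sqrt v) u * indicator {..x} u) \<partial>lborel)"
    by (intro nn_integral_cong) (auto simp: indicator_def)
  finally show ?thesis
    unfolding normal_cdf_def measure_def
    by (subst integral_eq_nn_integral) (auto simp: indicator_def)
qed

text \<open>For a > 0, a Z \<le> x means Z \<le> x / a. With a = \<open>slope\<close> this turns a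
  half-line for the rescaled magnetization into one for the estimator.\<close>

lemma normal_cdf_scale:
  assumes "s > 0" "a > 0"
  shows "normal_cdf ((a * s)\<^sup>2) x = normal_cdf (s\<^sup>2) (x / a)"
proof -
  have "normal_cdf ((a * s)\<^sup>2) x =
      \<bar>a\<bar> *\<^sub>R (\<integral>u. normal_density 0 (a * s) (0 + a * u) * indicator {..x} (0 + a * u) \<partial>lborel)"
    unfolding normal_cdf_eq using assms
    by (subst lborel_integral_real_affine[of a _ 0]) (auto simp: real_sqrt_unique)
  also have "\<dots> = (\<integral>u. a * (normal_density 0 (a * s) (a * u) * indicator {..x} (a * u)) \<partial>lborel)"
    using assms by simp
  also have "\<dots> = (\<integral>u. normal_density 0 s u * indicator {..x / a} u \<partial>lborel)"
  proof (intro Bochner_Integration.integral_cong refl)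
    fix u
    have "sqrt (2 * pi * (a * s)\<^sup>2) = a * sqrt (2 * pi * s\<^sup>2)"
      using assms by (simp add: power_mult_distrib real_sqrt_mult)
    moreover have "- (a * u - 0)\<^sup>2 / (2 * (a * s)\<^sup>2) = - (u - 0)\<^sup>2 / (2 * s\<^sup>2)"
      using assms by (simp add: power_mult_distrib)
    ultimately have "a * normal_density 0 (a * s) (a * u) = normal_density 0 s u"
      unfolding normal_density_def using assms by simp
    moreover have "indicator {..x} (a * u) = (indicator {..x / a} u :: real)"
      using assms by (auto simp: indicator_def field_simps)
    ultimately show "a * (normal_density 0 (a * s) (a * u) * indicator {..x} (a * u)) =
        normal_density 0 s u * indicator {..x / a} u"
      by (simp add: mult.assoc[symmetric])
  qed
  finally show ?thesis
    unfolding normal_cdf_eq[of "s\<^sup>2"] using assms by simp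
qed

text \<open>The numerator uses the half-line up to x / slope, with its endpoint as the excluded
  point; the denominator uses the whole line, where the density integrates to 1. The common
  constants then cancel in the quotient.\<close>

lemma (in cw_maximizer) mpl_central_limit:
  "(\<lambda>N. cw_prob p N \<beta> {X. mpl_est p N X < \<infinity> \<and> sqrt (real N) * (real_of_ereal (mpl_est p N X) - \<beta>) \<le> x})
     \<longlonglongrightarrow> normal_cdf ((slope * sigma)\<^sup>2) x"
proof -
  let ?e = "if even p then 2 else 1 :: real"
  obtain C where C: "C > 0"
    "\<And>Q L y. (\<And>k u. u \<noteq> y \<Longrightarrow> (\<lambda>N. sqrt (real N) * (mag N (k N) - m)) \<longlonglongrightarrow> u \<Longrightarrow>
          \<forall>\<^sub>F N in sequentially. Q N (mag N (k N)) \<longleftrightarrow> u \<in> L) \<Longrightarrow> L \<in> sets borel \<Longrightarrow>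
       (\<lambda>N. \<Sum>k | k \<le> N \<and> N < 2 * k. weight N k * of_bool (Q N (mag N k))) \<longlonglongrightarrow>
         C * (\<integral>u. normal_density 0 sigma u * indicator L u \<partial>lborel)"
    using positive_weight_sum_limit by blast
  have "(\<lambda>N. \<Sum>k\<le>N. weight N k * of_bool (mpl_event x N (mag N k))) \<longlonglongrightarrow>
      ?e * (C * (\<integral>u. normal_density 0 sigma u * indicator {..x / slope} u \<partial>lborel))"
  proof (intro weight_sum_tendsto C(2)[where y = "x / slope"] mpl_event_limit)
    show "\<forall>N t. mpl_event x N (- t) = mpl_event x N t" if "even p"
      using that p_ge_2 by (simp add: mpl_event_def mean_mpl_minus)
  qed auto
  moreover have "(\<integral>u. normal_density 0 sigma u * indicator {..x / slope} u \<partial>lborel) =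
      normal_cdf ((slope * sigma)\<^sup>2) x"
    using normal_cdf_scale[OF sigma_pos slope_pos] sigma_pos by (simp add: normal_cdf_eq)
  ultimately have num: "(\<lambda>N. \<Sum>k\<le>N. weight N k * of_bool (mpl_event x N (mag N k))) \<longlonglongrightarrow>
      ?e * (C * normal_cdf ((slope * sigma)\<^sup>2) x)"
    by simp
  have "(\<lambda>N. \<Sum>k\<le>N. weight N k * of_bool True) \<longlonglongrightarrow>
      ?e * (C * (\<integral>u. normal_density 0 sigma u * indicator UNIV u \<partial>lborel))"
    by (rule weight_sum_tendsto[of "\<lambda>_ _. True"], rule C(2)[where Q = "\<lambda>_ _. True"]) auto
  then have den: "(\<lambda>N. \<Sum>k\<le>N. weight N k * of_bool True) \<longlonglongrightarrow> ?e * C"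
    using sigma_pos by simp
  have "(\<lambda>N. (\<Sum>k\<le>N. weight N k * of_bool (mpl_event x N (mag N k))) / (\<Sum>k\<le>N. weight N k * of_bool True))
      \<longlonglongrightarrow> ?e * (C * normal_cdf ((slope * sigma)\<^sup>2) x) / (?e * C)"
    by (rule tendsto_divide[OF num den]) (use C(1) in auto)
  moreover have "?e * (C * normal_cdf ((slope * sigma)\<^sup>2) x) / (?e * C) = normal_cdf ((slope * sigma)\<^sup>2) x"
    using C(1) by simp
  ultimately have "(\<lambda>N. (\<Sum>k\<le>N. weight N k * of_bool (mpl_event x N (mag N k))) / (\<Sum>k\<le>N. weight N k * of_bool True))
      \<longlonglongrightarrow> normal_cdf ((slope * sigma)\<^sup>2) x"
    by (simp only:)
  moreover have "\<forall>\<^sub>F N in sequentially.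
      (\<Sum>k\<le>N. weight N k * of_bool (mpl_event x N (mag N k))) / (\<Sum>k\<le>N. weight N k * of_bool True) =
      cw_prob p N \<beta> {X. mpl_est p N X < \<infinity> \<and> sqrt (real N) * (real_of_ereal (mpl_est p N X) - \<beta>) \<le> x}"
    using eventually_gt_at_top[of 0] by eventually_elim (rule cw_prob_eq[symmetric])
  ultimately show ?thesis
    by (rule Lim_transform_eventually)
qed

theorem mainTheorem17:
  fixes p :: nat and \<beta> :: real
  assumes "p \<ge> 2" and "\<beta> > cw_beta_star p"
  shows "\<exists>m. (0 < m \<and> m \<le> 1 \<and> (\<forall>t\<in>{-1..1}. cw_g \<beta> p t \<le> cw_g \<beta> p m))
          \<and> (\<forall>m'. 0 < m' \<and> m' \<le> 1 \<and> (\<forall>t\<in>{-1..1}. cw_g \<beta> p t \<le> cw_g \<beta> p m') \<longrightarrow> m' = m)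
          \<and> (\<forall>x::real.
               (\<lambda>N. cw_prob p N \<beta> {X. mpl_est p N X < \<infinity> \<and>
                      sqrt (real N) * (real_of_ereal (mpl_est p N X) - \<beta>) \<le> x})
               \<longlonglongrightarrow> normal_cdf (- deriv (deriv (cw_g \<beta> p)) m / (real p ^ 2 * m ^ (2 * p - 2))) x)"
proof -
  obtain m where "cw_maximizer p \<beta> m"
    using cw_maximizer_exists[OF assms] .
  then interpret cw_maximizer p \<beta> m .
  have "deriv (deriv (cw_g \<beta> p)) m = g'' m"
    using deriv_deriv_cw_g[of m \<beta> p] m_pos m_less_1 by (simp add: g''_def)
  moreover have "(slope * sigma)\<^sup>2 = - g'' m / (real p ^ 2 * m ^ (2 * p - 2))"
  proof -
    have "m ^ (2 * p - 2) = (m ^ (p - 1))\<^sup>2"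
      by (simp add: diff_mult_distrib2 mult.commute flip: power_mult)
    then have "slope\<^sup>2 = (g'' m)\<^sup>2 / (real p ^ 2 * m ^ (2 * p - 2))"
      by (simp add: slope_def power_divide power_mult_distrib)
    moreover have "(slope * sigma)\<^sup>2 = slope\<^sup>2 * (1 / (- g'' m))"
      by (simp only: power_mult_distrib sigma_sq)
    ultimately show ?thesis
      using g''_neg[of m] m_less_1 by (simp add: power2_eq_square)
  qed
  ultimately have var: "- deriv (deriv (cw_g \<beta> p)) m / (real p ^ 2 * m ^ (2 * p - 2)) = (slope * sigma)\<^sup>2"
    by simp
  show ?thesis
  proof (intro exI[of _ m] conjI allI impI)
    fix m' assume m': "0 < m' \<and> m' \<le> 1 \<and> (\<forall>t\<in>{-1..1}. cw_g \<beta> p t \<le> cw_g \<beta> p m')"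
    then have "g m' = g m"
      using max[of m'] m_pos m_less_1 by (intro antisym) auto
    then show "m' = m"
      using m' by (intro maximizer_unique) auto
  next
    fix x :: real
    show "(\<lambda>N. cw_prob p N \<beta> {X. mpl_est p N X < \<infinity> \<and>
              sqrt (real N) * (real_of_ereal (mpl_est p N X) - \<beta>) \<le> x})
            \<longlonglongrightarrow> normal_cdf (- deriv (deriv (cw_g \<beta> p)) m / (real p ^ 2 * m ^ (2 * p - 2))) x"
      unfolding var by (rule mpl_central_limit)
  qed (use m_pos m_le_1 max in auto)
qed

end
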